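(* Let $M$ be a bipath module, i.e. a persistence module over the bipath poset $B$. Then the following equalities hold between multiplicities in the arc code of $M$ and multiplicities in the barcode of the finite zigzag module $R'(M)=M\circ\zeta'$ over $\mathbb{ZZ}'$. \begin{itemize} \item For the full interval $B$: $\mu_M(B)=\mu_{R'(M)}(\mathbb{ZZ}')$. \item For a left interval $[i,j]_{\vartriangleleft}$: if $j=0$, then $\mu_M([i,0]_{\vartriangleleft})=\mu_{R'(M)}\big((0,i+1)_{\mathbb{ZZ}}\big)$; if $j\neq 0$, then $\mu_M([i,j]_{\vartriangleleft})=\mu_{R'(M)}\big((-n-m+j,\,i+1)_{\mathbb{ZZ}}\big)$. \item For a right interval $[i,j]_{\vartriangleright}$: $\mu_M([i,j]_{\vartriangleright})=\mu_{R'(M)}\big([i,j]_{\mathbb{ZZ}}\big)$. \item For a top interval $[i,j]_{\top}$: $\mu_M([i,j]_{\top})=\mu_{R'(M)}\big([i,j+1)_{\mathbb{ZZ}}\big)$. \item For a bottom interval $[i,j]_{\bot}$: $\mu_M([i,j]_{\bot})=\mu_{R'(M)}\big((i-1,j]_{\mathbb{ZZ}}\big)$. \end{itemize}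
   Context: Fix a field $\Bbbk$. A persistence module over a poset $P$ is a functor from $P$ to the category of finite-dimensional $\Bbbk$-vector spaces. An interval of $P$ is a non-empty, connected, convex subposet; the interval module $\Bbbk I$ is $\Bbbk$ on $I$ and $0$ elsewhere, with identity internal maps inside $I$ and zero maps otherwise. Bipath poset: fix integers $n,m>1$ and let $B=\{0,1,\dots,n+m-1\}$ with the partial order $\le$ given by the two maximal chains $0<1<\cdots<n-1<n$ and $0<n+m-1<n+m-2<\cdots<n+1<n$. Set $N=n+m-1$. The intervals of $B$ are of the following types (all inequalities in the order of $B$): full: $B$ itself; left: $[i,j]_{\vartriangleleft}=\{z\in B: 0\le z\le i\}\cup\{z\in B: 0\le z\le j\}$ for $i\in\{0,1,\dots,n-1\}$, $j\in\{0,n+m-1,\dots,n+1\}$; right: $[i,j]_{\vartriangleright}=\{z\in B: i\le z\le n\}\cup\{z\in B: j\le z\le n\}$ for $i\in\{1,\dots,n-1,n\}$, $j\in\{n+m-1,\dots,n+1,n\}$; top: $[i,j]_{\top}=\{z\in B: i\le z\le j\}$ for $i,j\in\{1,\dots,n-1\}$ (non-empty, so $i\le j$); bottom: $[i,j]_{\bot}=\{z\in B: j\le z\le i\}$ for $i,j\in\{n+m-1,\dots,n+1\}$ (non-empty, so $j\le i$ in the order of $B$). Every persistence module $M$ over $B$ is isomorphic to a direct sum of interval modules indexed by a unique multiset $\mathcal{B}(M)$ of intervals, its arc code. Zigzag poset: $\mathbb{ZZ}=\{(a,b)\in\mathbb{Z}^{\mathrm{op}}\times\mathbb{Z}: a=b\text{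 or }a=b+1\}$. For $a,b\in\mathbb{Z}\cup\{\pm\infty\}$: $[a,b]_{\mathbb{ZZ}}=\{(c,d)\in\mathbb{ZZ}: c\le b,\ d\ge a\}$, $[a,b)_{\mathbb{ZZ}}=\{(c,d)\in\mathbb{ZZ}: a\le d<b\}$, $(a,b]_{\mathbb{ZZ}}=\{(c,d)\in\mathbb{ZZ}: a<c\le b\}$, $(a,b)_{\mathbb{ZZ}}=\{(c,d)\in\mathbb{ZZ}: c>a,\ d<b\}$ (inequalities between integers in the usual order). Covering map: $\zeta\colon\mathbb{ZZ}\to B$ is the poset map given, for every $k\in\mathbb{Z}$, by $\zeta(kN+1,kN)=0$; $\zeta(kN+i,kN+i)=\zeta(kN+i+1,kN+i)=i$ for $i\in\{1,\dots,n-1\}$; $\zeta(kN+n,kN+n)=n$; $\zeta(kN-i+1,kN-i)=\zeta(kN-i+1,kN-i+1)=n+m-i$ for $i\in\{1,\dots,m-1\}$. Finite slice: $\mathbb{ZZ}'=(-m+1,n+m)_{\mathbb{ZZ}}\subset\mathbb{ZZ}$, a finite zigzag poset with $2n+4m-3$ elements; $\zeta'\colon\mathbb{ZZ}'\to B$ is the restriction of $\zeta$, and $R'$ is the functor $M\mapsto M\circ\zeta'$. Persistence modules over $\mathbb{ZZ}'$ decompose uniquely (up to isomorphism and order) into interval modules, giving their barcode. The intervals in the claim written with subscript $\mathbb{ZZ}$ are regarded as intervals of $\mathbb{ZZ}'$. $\mu_M(I)$ denotes the multiplicity of the interval $I$ in the arc code of $M$, and $\mu_{R'(M)}(J)$ the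 multiplicity of the interval $J$ of $\mathbb{ZZ}'$ in the barcode of $R'(M)$ (zero if the interval does not occur). *)

theory Defs
  imports Complex_Main "HOL-Library.Multiset" "HOL-Library.Function_Algebras"
begin

section \<open>Persistence modules over a poset\<close>

text \<open>
  A poset is given by its order relation \<open>r\<close>, a set of pairs that is a partial order on the
  underlying set \<open>Field r\<close>. The vector spaces of a persistence module are finite-dimensional
  subspaces \<open>spc M p\<close> of an arbitrary ambient vector space with scalar multiplication \<open>scl M\<close>;
  every family of vector spaces embeds in such an ambient space (its direct sum). Only the values
  \<open>trn M p q x\<close> with \<open>(p, q) \<in> r\<close> and \<open>x \<in> spc M p\<close> are meaningful.
\<close>

record ('p, 'k, 'v) persistence =
  scl :: "'k \<Rightarrow> 'v \<Rightarrow> 'v"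
  spc :: "'p \<Rightarrow> 'v set"
  trn :: "'p \<Rightarrow> 'p \<Rightarrow> 'v \<Rightarrow> 'v"

definition linear_between ::
  "('k \<Rightarrow> 'v::plus \<Rightarrow> 'v) \<Rightarrow> ('k \<Rightarrow> 'w::plus \<Rightarrow> 'w) \<Rightarrow> 'v set \<Rightarrow> 'w set \<Rightarrow> ('v \<Rightarrow> 'w) \<Rightarrow> bool"
where
  "linear_between s t V W f \<longleftrightarrow>
     f ` V \<subseteq> W \<and>
     (\<forall>x\<in>V. \<forall>y\<in>V. f (x + y) = f x + f y) \<and>
     (\<forall>c. \<forall>x\<in>V. f (s c x) = t c (f x))"

definition persistence_module ::
  "('p \<times> 'p) set \<Rightarrow> ('p, 'k::field, 'v::ab_group_add) persistence \<Rightarrow> bool"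
where
  "persistence_module r M \<longleftrightarrow>
     vector_space (scl M) \<and>
     (\<forall>p\<in>Field r. module.subspace (scl M) (spc M p) \<and>
        (\<exists>X. finite X \<and> module.span (scl M) X = spc M p)) \<and>
     (\<forall>(p, q)\<in>r. linear_between (scl M) (scl M) (spc M p) (spc M q) (trn M p q)) \<and>
     (\<forall>p\<in>Field r. \<forall>x\<in>spc M p. trn M p p x = x) \<and>
     (\<forall>p q s. (p, q) \<in> r \<longrightarrow> (q, s) \<in> r \<longrightarrow>
        (\<forall>x\<in>spc M p. trn M q s (trn M p q x) = trn M p s x))"

definition persistence_iso ::
  "('p \<times> 'p) set \<Rightarrow> ('p, 'k, 'v::plus) persistence \<Rightarrow> ('p, 'k, 'w::plus) persistence \<Rightarrow> bool"
where
  "persistence_iso r M N \<longleftrightarrow>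
     (\<exists>\<phi>. (\<forall>p\<in>Field r. linear_between (scl M) (scl N) (spc M p) (spc N p) (\<phi> p) \<and>
                          bij_betw (\<phi> p) (spc M p) (spc N p)) \<and>
          (\<forall>(p, q)\<in>r. \<forall>x\<in>spc M p. \<phi> q (trn M p q x) = trn N p q (\<phi> p x)))"

text \<open>The composite \<open>M \<circ> f\<close> of a persistence module with a poset map.\<close>

definition pullback :: "('q \<Rightarrow> 'p) \<Rightarrow> ('p, 'k, 'v) persistence \<Rightarrow> ('q, 'k, 'v) persistence" where
  "pullback f M =
     \<lparr>scl = scl M, spc = (\<lambda>p. spc M (f p)), trn = (\<lambda>p q. trn M (f p) (f q))\<rparr>"

text \<open>
  The direct sum of a family \<open>(M s)\<^sub>s\<^sub>\<in>\<^sub>S\<close>, for finite \<open>S\<close>. Its vectors are families of vectors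
  that vanish outside \<open>S\<close>; addition is pointwise.
\<close>

definition direct_sum ::
  "('i \<Rightarrow> ('p, 'k, 'v::zero) persistence) \<Rightarrow> 'i set \<Rightarrow> ('p, 'k, 'i \<Rightarrow> 'v) persistence"
where
  "direct_sum M S =
     \<lparr>scl = (\<lambda>c h s. scl (M s) c (h s)),
      spc = (\<lambda>p. {h. (\<forall>s\<in>S. h s \<in> spc (M s) p) \<and> (\<forall>s. s \<notin> S \<longrightarrow> h s = 0)}),
      trn = (\<lambda>p q h s. if s \<in> S then trn (M s) p q (h s) else 0)\<rparr>"


section \<open>Intervals and barcodes\<close>

definition is_interval :: "('p \<times> 'p) set \<Rightarrow> 'p set \<Rightarrow> bool" where
  "is_interval r I \<longleftrightarrow>
     I \<noteq> {} \<and> I \<subseteq> Field r \<and>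
     (\<forall>x\<in>I. \<forall>y\<in>I. (x, y) \<in> (Restr (r \<union> r\<inverse>) I)\<^sup>*) \<and>
     (\<forall>x\<in>I. \<forall>z\<in>I. \<forall>y. (x, y) \<in> r \<longrightarrow> (y, z) \<in> r \<longrightarrow> y \<in> I)"

definition interval_module :: "'p set \<Rightarrow> ('p, 'k::field, 'k) persistence" where
  "interval_module I =
     \<lparr>scl = (*),
      spc = (\<lambda>p. if p \<in> I then UNIV else {0}),
      trn = (\<lambda>p q x. if p \<in> I \<and> q \<in> I then x else 0)\<rparr>"

text \<open>The summands are indexed by the pairs \<open>(I, c)\<close> with \<open>c < count \<B> I\<close>.\<close>

definition interval_sum ::
  "'p set multiset \<Rightarrow> ('p, 'k::field, 'p set \<times> nat \<Rightarrow> 'k) persistence"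
where
  "interval_sum \<B> = direct_sum (\<lambda>(I, c). interval_module I) {(I, c). c < count \<B> I}"

definition decomposes_into ::
  "('p \<times> 'p) set \<Rightarrow> ('p, 'k::field, 'v::ab_group_add) persistence \<Rightarrow> 'p set multiset \<Rightarrow> bool"
where
  "decomposes_into r M \<B> \<longleftrightarrow> (\<forall>I\<in>#\<B>. is_interval r I) \<and> persistence_iso r M (interval_sum \<B>)"

text \<open>The arc code, when \<open>r\<close> is a bipath poset.\<close>

definition barcode ::
  "('p \<times> 'p) set \<Rightarrow> ('p, 'k::field, 'v::ab_group_add) persistence \<Rightarrow> 'p set multiset"
where
  "barcode r M = (THE \<B>. decomposes_into r M \<B>)"

definition interval_mult ::
  "('p \<times> 'p) set \<Rightarrow> ('p, 'k::field, 'v::ab_group_add) persistence \<Rightarrow> 'p set \<Rightarrow> nat"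
where
  "interval_mult r M I = count (barcode r M) I"


section \<open>The bipath poset\<close>

definition bipath_set :: "int \<Rightarrow> int \<Rightarrow> int set" where
  "bipath_set n m = {0..n + m - 1}"

text \<open>
  The union of the order relations of the two chains \<open>0 < 1 < \<dots> < n\<close> and
  \<open>0 < n + m - 1 < n + m - 2 < \<dots> < n + 1 < n\<close>. On the second chain the order of the nonzero
  elements is the reverse of the order of the integers.
\<close>

definition bipath :: "int \<Rightarrow> int \<Rightarrow> (int \<times> int) set" where
  "bipath n m =
     {(x, y). 0 \<le> x \<and> x \<le> y \<and> y \<le> n} \<union>
     {(x, y). x = 0 \<and> (y = 0 \<or> y \<in> {n..n + m - 1}) \<or> n \<le> y \<and> y \<le> x \<and> x \<le> n + m - 1}"

lemma partial_order_on_bipath: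
  assumes "n > 1" "m > 1"
  shows "partial_order_on (bipath_set n m) (bipath n m)"
  using assms
  unfolding partial_order_on_def preorder_on_def bipath_def bipath_set_def
  by (auto simp: refl_on_def trans_def antisym_def)

lemma Field_bipath:
  assumes "n > 1" "m > 1"
  shows "Field (bipath n m) = bipath_set n m"
  using assms unfolding bipath_def bipath_set_def Field_def Domain_unfold by fastforce

definition segment :: "('p \<times> 'p) set \<Rightarrow> 'p \<Rightarrow> 'p \<Rightarrow> 'p set" where
  "segment r x y = {z. (x, z) \<in> r \<and> (z, y) \<in> r}"

definition left_interval :: "int \<Rightarrow> int \<Rightarrow> int \<Rightarrow> int \<Rightarrow> int set" where
  "left_interval n m i j = segment (bipath n m) 0 i \<union> segment (bipath n m) 0 j"

definition right_interval :: "int \<Rightarrow> int \<Rightarrow> int \<Rightarrow> int \<Rightarrow> int set" where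
  "right_interval n m i j = segment (bipath n m) i n \<union> segment (bipath n m) j n"

definition top_interval :: "int \<Rightarrow> int \<Rightarrow> int \<Rightarrow> int \<Rightarrow> int set" where
  "top_interval n m i j = segment (bipath n m) i j"

definition bottom_interval :: "int \<Rightarrow> int \<Rightarrow> int \<Rightarrow> int \<Rightarrow> int set" where
  "bottom_interval n m i j = segment (bipath n m) j i"


section \<open>The zigzag poset and the covering map\<close>

definition zz_set :: "(int \<times> int) set" where
  "zz_set = {(a, b). a = b \<or> a = b + 1}"

text \<open>The order is inherited from the product of the opposite of the integers with the integers.\<close>

definition zz :: "((int \<times> int) \<times> (int \<times> int)) set" where
  "zz = {((a, b), (c, d)). (a, b) \<in> zz_set \<and> (c, d) \<in> zz_set \<and> c \<le> a \<and> b \<le> d}"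

text \<open>The suffixes \<open>c\<close> and \<open>o\<close> stand for a closed and an open end.\<close>

definition zz_cc :: "int \<Rightarrow> int \<Rightarrow> (int \<times> int) set" where
  "zz_cc a b = {(c, d) \<in> zz_set. c \<le> b \<and> d \<ge> a}"

definition zz_co :: "int \<Rightarrow> int \<Rightarrow> (int \<times> int) set" where
  "zz_co a b = {(c, d) \<in> zz_set. a \<le> d \<and> d < b}"

definition zz_oc :: "int \<Rightarrow> int \<Rightarrow> (int \<times> int) set" where
  "zz_oc a b = {(c, d) \<in> zz_set. a < c \<and> c \<le> b}"

definition zz_oo :: "int \<Rightarrow> int \<Rightarrow> (int \<times> int) set" where
  "zz_oo a b = {(c, d) \<in> zz_set. c > a \<and> d < b}"

definition zz_slice_set :: "int \<Rightarrow> int \<Rightarrow> (int \<times> int) set" where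
  "zz_slice_set n m = zz_oo (- m + 1) (n + m)"

definition zz_slice :: "int \<Rightarrow> int \<Rightarrow> ((int \<times> int) \<times> (int \<times> int)) set" where
  "zz_slice n m = Restr zz (zz_slice_set n m)"

text \<open>
  A closed form of the covering map. The lemma \<open>zeta_eqs\<close> gives its values case by case; these
  cases exhaust \<open>zz_set\<close>.
\<close>

definition zeta :: "int \<Rightarrow> int \<Rightarrow> int \<times> int \<Rightarrow> int" where
  "zeta n m = (\<lambda>(c, d). let N = n + m - 1 in
     if c = d then (c - 1) mod N + 1
     else if d mod N < n then d mod N
     else d mod N + 1)"

lemma zeta_eqs:
  fixes n m k i :: int
  assumes "n > 1" "m > 1"
  defines "N \<equiv> n + m - 1"
  shows "zeta n m (k * N + 1, k * N) = 0"
    and "i \<in> {1..n - 1} \<Longrightarrow> zeta n m (k * N + i, k * N + i) = i"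
    and "i \<in> {1..n - 1} \<Longrightarrow> zeta n m (k * N + i + 1, k * N + i) = i"
    and "zeta n m (k * N + n, k * N + n) = n"
    and "i \<in> {1..m - 1} \<Longrightarrow> zeta n m (k * N - i + 1, k * N - i) = n + m - i"
    and "i \<in> {1..m - 1} \<Longrightarrow> zeta n m (k * N - i + 1, k * N - i + 1) = n + m - i"
proof -
  have mod: "(k * N + x) mod N = x" if "0 \<le> x" "x < N" for k x
    using that by (simp add: mod_pos_pos_trivial)
  show "zeta n m (k * N + 1, k * N) = 0"
    using assms mod[of 0 k] by (simp add: zeta_def)
  show "zeta n m (k * N + i, k * N + i) = i" if "i \<in> {1..n - 1}"
    using assms that mod[of "i - 1" k] by (simp add: zeta_def Let_def algebra_simps)
  show "zeta n m (k * N + i + 1, k * N + i) = i" if "i \<in> {1..n - 1}"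
    using assms that mod[of i k] by (simp add: zeta_def Let_def)
  show "zeta n m (k * N + n, k * N + n) = n"
    using assms mod[of "n - 1" k] by (simp add: zeta_def Let_def algebra_simps)
  have shift: "k * N - i = (k - 1) * N + (N - i)" for i
    by (simp add: algebra_simps)
  have neg: "(k * N - i) mod N = N - i" if "i \<in> {1..m - 1}" for i
    unfolding shift using that assms by (intro mod) auto
  show "zeta n m (k * N - i + 1, k * N - i) = n + m - i" if "i \<in> {1..m - 1}"
    using assms that neg[OF that] by (simp add: zeta_def Let_def)
  show "zeta n m (k * N - i + 1, k * N - i + 1) = n + m - i" if "i \<in> {1..m - 1}"
    using assms that neg[OF that] by (simp add: zeta_def Let_def)
qed

text \<open>The functor of restriction along the covering map, used over \<open>zz_slice n m\<close>.\<close>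

definition restrict_slice ::
  "int \<Rightarrow> int \<Rightarrow> (int, 'k, 'v) persistence \<Rightarrow> (int \<times> int, 'k, 'v) persistence"
where
  "restrict_slice n m M = pullback (zeta n m) M"

end

theory Submission
  imports Defs
begin

text \<open>
  A module over the bipath poset is a direct sum of interval modules, restriction along a poset map
  commutes with direct sums, and the restriction of the interval module of \<open>I\<close> is the direct sum
  of the interval modules of the connected components of the preimage of \<open>I\<close>. The multiplicity of
  an interval \<open>K\<close> in the restricted module is therefore the number of summands \<open>I\<close> of the bipath
  module for which \<open>K\<close> is a component of the preimage of \<open>I\<close>
  (\<open>interval_mult_pullback\<close>). The slice winds around the bipath poset more than once, so
  preimages may have a second component, cut off by an end of the slice. But each \<open>K\<close> of the
  theorem is a component of the preimage of exactly one interval \<open>I\<close>, the one that it is paired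
  with: \<open>I\<close> is the image of \<open>K\<close>, and any interval that contains \<open>I\<close> and has \<open>K\<close> as a component of
  its preimage avoids the images of the neighbours of \<open>K\<close>, which separate \<open>I\<close> from the rest of the
  bipath poset (\<open>zigzag_component_iff\<close>).

  Decompositions are handled inside the module as an \<open>interval_basis\<close>: a basis of every vector
  space, together with the dual coordinates, that the transition maps respect. Three facts about
  them carry the proof.

  Uniqueness (\<open>interval_mult_interval_basis\<close>) holds over every poset: a composite of maps of
  interval modules from \<open>I\<close> to a different interval and back to \<open>I\<close> is zero, so the base change
  matrices between two interval bases restrict to mutually inverse matrices between the summands
  of type \<open>I\<close>.

  Existence (\<open>bipath_interval_basis_exists\<close>) follows by induction on the total dimension once every
  nonzero module has an interval summand (\<open>interval_summand_exists\<close>). If the map from the least to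
  the greatest element is nonzero, the full interval splits off. If it is zero and the
  space at the least element is not, there are two filtrations of that space, by the kernels of
  the maps into either chain; a vector in the first nonzero intersection of their members
  generates a left interval, and a functional that separates it from the preceding kernel splits it
  off. The images in the space at the greatest element give right intervals in the dual way. If
  both spaces vanish, the module lives on two disjoint chains, where the same argument is
  elementary.

  Pullback (\<open>interval_basis_pullback\<close>) restricts each basis vector to the components of the
  preimage of its interval.
\<close>

section \<open>Linear maps on subspaces and functionals\<close>

lemma linear_betweenD:
  assumes "linear_between s t V W f"
  shows "x \<in> V \<Longrightarrow> f x \<in> W"
    and "x \<in> V \<Longrightarrow> y \<in> V \<Longrightarrow> f (x + y) = f x + f y"
    and "x \<in> V \<Longrightarrow> f (s c x) = t c (f x)"
  using assms unfolding linear_between_def by auto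

lemma linear_between_comp:
  assumes "linear_between s t V W f" and "linear_between t u W X g"
  shows "linear_between s u V X (\<lambda>x. g (f x))"
  using assms unfolding linear_between_def image_subset_iff by simp

context vector_space
begin

lemma linear_between_zero:
  fixes f :: "'b \<Rightarrow> 'w::ab_group_add"
  assumes "linear_between scale t V W f" and "subspace V"
  shows "f 0 = 0"
proof -
  have "f (0 + 0) = f 0 + f 0"
    using assms subspace_0 by (intro linear_betweenD(2)[OF assms(1)]) auto
  then show ?thesis by simp
qed

lemma linear_between_sum:
  fixes f :: "'b \<Rightarrow> 'w::ab_group_add"
  assumes f: "linear_between scale t V W f" and V: "subspace V"
    and x: "\<And>i. i \<in> A \<Longrightarrow> x i \<in> V"
  shows "f (\<Sum>i\<in>A. scale (c i) (x i)) = (\<Sum>i\<in>A. t (c i) (f (x i)))"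
  using x
proof (induction A rule: infinite_finite_induct)
  case (insert i A)
  have "(\<Sum>i\<in>A. scale (c i) (x i)) \<in> V"
    using insert V by (auto intro!: subspace_sum subspace_scale)
  then show ?case
    using insert V by (simp add: linear_betweenD[OF f] subspace_scale)
qed (simp_all add: linear_between_zero[OF f V])

lemma linear_between_diff:
  fixes f :: "'b \<Rightarrow> 'a"
  assumes f: "linear_between scale (*) V W f" and V: "subspace V" and "x \<in> V" "y \<in> V"
  shows "f (x - scale c y) = f x - c * f y"
proof -
  have "f (x + scale (- c) y) = f x + - c * f y"
    using assms by (simp add: linear_betweenD[OF f] subspace_scale subspace_neg flip: scale_minus_left)
  then show ?thesis by simp
qed

lemma linear_between_UNIV:
  assumes "Vector_Spaces.linear scale (*) f"
  shows "linear_between scale (*) V UNIV f"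
  using assms unfolding linear_between_def Vector_Spaces.linear_iff by auto

lemma vector_space_over_field: "vector_space ((*) :: 'a \<Rightarrow> 'a \<Rightarrow> 'a)"
  by unfold_locales (simp_all add: algebra_simps)

lemma separating_functional:
  assumes U: "subspace U" and "v \<notin> U"
  obtains f where "Vector_Spaces.linear scale (*) f" "\<And>u. u \<in> U \<Longrightarrow> f u = 0" "f v = 1"
proof -
  interpret field: vector_space "(*) :: 'a \<Rightarrow> 'a \<Rightarrow> 'a" by (rule vector_space_over_field)
  interpret pair: vector_space_pair scale "(*)" ..
  obtain B where B: "B \<subseteq> U" "independent B" "U \<subseteq> span B"
    by (rule maximal_independent_subset)
  have span: "span B = U"
    using B U span_minimal by blast
  with B assms have "independent (insert v B)"
    by (simp add: independent_insertI)
  then obtain f where f: "Vector_Spaces.linear scale (*) f"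
    "\<forall>x\<in>insert v B. f x = (if x = v then 1 else 0)"
    using pair.linear_independent_extend[of "insert v B" "\<lambda>x. if x = v then 1 else 0"] by blast
  have zero: "f u = 0" if "u \<in> U" for u
  proof (rule pair.linear_eq_0_on_span[OF f(1)])
    show "u \<in> span B" using that span by simp
    show "f x = 0" if "x \<in> B" for x
      using f(2) that B(1) assms(2) by auto
  qed
  show ?thesis
    by (rule that[OF f(1) zero]) (use f(2) in auto)
qed

text \<open>The functional is prescribed on a basis of \<open>T ` V\<close> by choosing preimages; the vanishing on
  the kernel makes the result independent of the choice.\<close>

lemma functional_factors:
  assumes T: "linear_between scale scale V W T" and V: "subspace V"
    and f: "linear_between scale (*) V UNIV f"
    and ker: "\<And>x. x \<in> V \<Longrightarrow> T x = 0 \<Longrightarrow> f x = 0"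
  obtains g where "Vector_Spaces.linear scale (*) g" "\<And>x. x \<in> V \<Longrightarrow> g (T x) = f x"
proof -
  interpret field: vector_space "(*) :: 'a \<Rightarrow> 'a \<Rightarrow> 'a" by (rule vector_space_over_field)
  interpret pair: vector_space_pair scale "(*)" ..
  obtain B where B: "B \<subseteq> T ` V" "independent B" "T ` V \<subseteq> span B"
    by (rule maximal_independent_subset)
  obtain g where g: "Vector_Spaces.linear scale (*) g" "\<forall>x\<in>B. g x = f (inv_into V T x)"
    using pair.linear_independent_extend[OF B(2), of "\<lambda>x. f (inv_into V T x)"] by blast
  have g_add: "g (x + y) = g x + g y" and g_scale: "g (scale c x) = c * g x" for c x y
    using g(1) unfolding Vector_Spaces.linear_iff by auto
  have eq: "f x = f y" if "x \<in> V" "y \<in> V" "T x = T y" for x y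
  proof -
    have "T (x + scale (- 1) y) = 0"
      using that V by (simp only: linear_betweenD[OF T] subspace_scale) simp
    then have "f (x - scale 1 y) = 0"
      using ker[of "x + scale (- 1) y"] that V by (simp add: subspace_diff)
    then show ?thesis
      using linear_between_diff[OF f V that(1,2), of 1] by simp
  qed
  have "\<exists>x\<in>V. T x = y \<and> g y = f x" if "y \<in> span B" for y
    using that
  proof (induction rule: span_induct_alt)
    case base
    show ?case
      using V linear_between_zero[OF T V] linear_between_zero[OF f V]
        g_scale[of 0] subspace_0[OF V] by (intro bexI[of _ 0]) auto
  next
    case (step c b y)
    then obtain x where x: "x \<in> V" "T x = y" "g y = f x" by auto
    define z where "z = inv_into V T b"
    have z: "z \<in> V" "T z = b" "g b = f z"
      using step B g(2) inv_into_into[of b T V] f_inv_into_f[of b T V] by (auto simp: z_def)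
    show ?case
      using x z V by (intro bexI[of _ "scale c z + x"])
        (auto simp: linear_betweenD[OF T] linear_betweenD[OF f] g_add g_scale
          subspace_scale subspace_add)
  qed
  then have "g (T x) = f x" if "x \<in> V" for x
    using that B(3) eq by (metis imageI subsetD)
  with g(1) show ?thesis using that by blast
qed

text \<open>Functionals dual to a family show that it is linearly independent, and the exchange lemma
  bounds the size of an independent set.\<close>

lemma card_le_if_dual_family:
  assumes "finite S" "finite X" and x: "\<And>s. s \<in> S \<Longrightarrow> x s \<in> span X" "\<And>s. s \<in> S \<Longrightarrow> x s \<in> V"
    and V: "subspace V" and l: "\<And>s. s \<in> S \<Longrightarrow> linear_between scale (*) V UNIV (l s)"
    and dual: "\<And>s t. s \<in> S \<Longrightarrow> t \<in> S \<Longrightarrow> l s (x t) = (if s = t then 1 else 0)"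
  shows "card S \<le> card X"
proof -
  have inj: "inj_on x S"
    using dual by (intro inj_onI) (metis zero_neq_one)
  have "independent (x ` S)"
  proof (rule independent_if_scalars_zero)
    show "finite (x ` S)" using assms(1) by simp
    fix f y assume sum: "(\<Sum>y\<in>x ` S. scale (f y) y) = 0" and "y \<in> x ` S"
    then obtain s where s: "s \<in> S" "y = x s" by auto
    have "0 = l s (\<Sum>t\<in>S. scale (f (x t)) (x t))"
      using sum linear_between_zero[OF l[OF s(1)] V] by (simp add: sum.reindex[OF inj])
    also have "\<dots> = (\<Sum>t\<in>S. f (x t) * l s (x t))"
      using x(2) by (intro linear_between_sum[OF l[OF s(1)] V])
    also have "\<dots> = (\<Sum>t\<in>S. if s = t then f (x t) else 0)"
      using s dual by (intro sum.cong) auto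
    also have "\<dots> = f y"
      using s assms(1) by simp
    finally show "f y = 0" by simp
  qed
  then have "card (x ` S) \<le> card X"
    using independent_span_bound[OF assms(2)] x(1) by auto
  then show ?thesis by (simp add: card_image[OF inj])
qed

end

section \<open>Interval bases\<close>

locale pmodule =
  fixes r :: "('p \<times> 'p) set" and M :: "('p, 'k::field, 'v::ab_group_add) persistence"
  assumes pm: "persistence_module r M"
begin

sublocale vector_space "scl M"
  using pm unfolding persistence_module_def by blast

lemma subspace_spc: "p \<in> Field r \<Longrightarrow> subspace (spc M p)"
  using pm unfolding persistence_module_def by blast

lemma finitely_spanned: "p \<in> Field r \<Longrightarrow> \<exists>X. finite X \<and> span X = spc M p"
  using pm unfolding persistence_module_def by blast

lemma linear_trn: "(p, q) \<in> r \<Longrightarrow> linear_between (scl M) (scl M) (spc M p) (spc M q) (trn M p q)"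
  using pm unfolding persistence_module_def by blast

lemma trn_in: "(p, q) \<in> r \<Longrightarrow> y \<in> spc M p \<Longrightarrow> trn M p q y \<in> spc M q"
  using linear_betweenD(1)[OF linear_trn] .

lemma trn_id: "p \<in> Field r \<Longrightarrow> y \<in> spc M p \<Longrightarrow> trn M p p y = y"
  using pm unfolding persistence_module_def by blast

lemma trn_trn:
  "(p, q) \<in> r \<Longrightarrow> (q, s) \<in> r \<Longrightarrow> y \<in> spc M p \<Longrightarrow> trn M q s (trn M p q y) = trn M p s y"
  using pm unfolding persistence_module_def by blast

lemma trn_zero: "(p, q) \<in> r \<Longrightarrow> trn M p q 0 = 0"
  using linear_between_zero[OF linear_trn subspace_spc] by (auto simp: Field_def)

lemma zero_in: "p \<in> Field r \<Longrightarrow> 0 \<in> spc M p"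
  using subspace_0[OF subspace_spc] .

abbreviation functional_on :: "'p \<Rightarrow> ('v \<Rightarrow> 'k) \<Rightarrow> bool" where
  "functional_on p f \<equiv> linear_between (scl M) (*) (spc M p) UNIV f"

lemma functional_trn:
  assumes "(p, q) \<in> r" "functional_on q f"
  shows "functional_on p (\<lambda>y. f (trn M p q y))"
  by (rule linear_between_comp[OF linear_trn[OF assms(1)] assms(2)])

end

text \<open>
  A decomposition into interval modules, seen inside \<open>M\<close>: the vectors \<open>x s p\<close> with \<open>p \<in> J s\<close>
  form a basis of \<open>spc M p\<close>, the functionals \<open>l s p\<close> are its coordinates, and the transition maps
  carry basis vectors to basis vectors or to zero. The index set is arbitrary, so that
  decompositions can be extended and refined without renaming summands.
\<close>

definition interval_basis ::
  "('p \<times> 'p) set \<Rightarrow> ('p, 'k::field, 'v::ab_group_add) persistence \<Rightarrow> 'i set \<Rightarrow> ('i \<Rightarrow> 'p set) \<Rightarrow>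
     ('i \<Rightarrow> 'p \<Rightarrow> 'v) \<Rightarrow> ('i \<Rightarrow> 'p \<Rightarrow> 'v \<Rightarrow> 'k) \<Rightarrow> bool"
where
  "interval_basis r M S J x l \<longleftrightarrow>
     finite S \<and>
     (\<forall>s\<in>S. is_interval r (J s)) \<and>
     (\<forall>s\<in>S. \<forall>p\<in>J s. x s p \<in> spc M p) \<and>
     (\<forall>s\<in>S. \<forall>p. p \<notin> J s \<longrightarrow> x s p = 0) \<and>
     (\<forall>s\<in>S. \<forall>(p, q)\<in>r. p \<in> J s \<longrightarrow> trn M p q (x s p) = x s q) \<and>
     (\<forall>s\<in>S. \<forall>p\<in>Field r. linear_between (scl M) (*) (spc M p) UNIV (l s p)) \<and>
     (\<forall>s\<in>S. \<forall>t\<in>S. \<forall>p\<in>Field r. l s p (x t p) = (if s = t \<and> p \<in> J t then 1 else 0)) \<and>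
     (\<forall>p\<in>Field r. \<forall>y\<in>spc M p. y = (\<Sum>s\<in>S. scl M (l s p y) (x s p)))"

locale interval_based = pmodule r M
  for r :: "('p \<times> 'p) set" and M :: "('p, 'k::field, 'v::ab_group_add) persistence" +
  fixes S :: "'i set" and J :: "'i \<Rightarrow> 'p set" and x :: "'i \<Rightarrow> 'p \<Rightarrow> 'v" and l :: "'i \<Rightarrow> 'p \<Rightarrow> 'v \<Rightarrow> 'k"
  assumes basis: "interval_basis r M S J x l"
begin

lemma finite_index: "finite S"
  using basis unfolding interval_basis_def by simp

lemma interval: "s \<in> S \<Longrightarrow> is_interval r (J s)"
  using basis unfolding interval_basis_def by simp

lemma interval_Field: "s \<in> S \<Longrightarrow> p \<in> J s \<Longrightarrow> p \<in> Field r"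
  using interval unfolding is_interval_def by blast

lemma vec_zero: "s \<in> S \<Longrightarrow> p \<notin> J s \<Longrightarrow> x s p = 0"
  using basis unfolding interval_basis_def by simp

lemma vec_in: "s \<in> S \<Longrightarrow> p \<in> Field r \<Longrightarrow> x s p \<in> spc M p"
  using basis zero_in unfolding interval_basis_def by metis

lemma trn_vec: "s \<in> S \<Longrightarrow> (p, q) \<in> r \<Longrightarrow> trn M p q (x s p) = (if p \<in> J s then x s q else 0)"
  using basis trn_zero[of p q] vec_zero[of s p] unfolding interval_basis_def by auto

lemma functional: "s \<in> S \<Longrightarrow> p \<in> Field r \<Longrightarrow> functional_on p (l s p)"
  using basis unfolding interval_basis_def by simp

lemma dual:
  "s \<in> S \<Longrightarrow> t \<in> S \<Longrightarrow> p \<in> Field r \<Longrightarrow> l s p (x t p) = (if s = t \<and> p \<in> J t then 1 else 0)"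
  using basis unfolding interval_basis_def by simp

lemma expansion: "p \<in> Field r \<Longrightarrow> y \<in> spc M p \<Longrightarrow> (\<Sum>s\<in>S. scl M (l s p y) (x s p)) = y"
  by (rule sym) (use basis in \<open>unfold interval_basis_def, blast\<close>)

lemma coordinate_sum:
  assumes "s \<in> S" "p \<in> Field r"
  shows "l s p (\<Sum>t\<in>S. scl M (c t) (x t p)) = (if p \<in> J s then c s else 0)"
proof -
  have "l s p (\<Sum>t\<in>S. scl M (c t) (x t p)) = (\<Sum>t\<in>S. c t * l s p (x t p))"
    using assms vec_in by (intro linear_between_sum[OF functional subspace_spc]) auto
  also have "\<dots> = (\<Sum>t\<in>S. if s = t then (if p \<in> J s then c s else 0) else 0)"
    using assms dual by (intro sum.cong) auto
  also have "\<dots> = (if p \<in> J s then c s else 0)"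
    using assms finite_index by (subst sum.delta') auto
  finally show ?thesis .
qed

lemma coordinate_outside: "s \<in> S \<Longrightarrow> p \<in> Field r \<Longrightarrow> y \<in> spc M p \<Longrightarrow> p \<notin> J s \<Longrightarrow> l s p y = 0"
  using coordinate_sum[of s p "\<lambda>t. l t p y"] expansion by simp

lemma coordinate_trn:
  assumes "s \<in> S" "(p, q) \<in> r" "y \<in> spc M p"
  shows "l s q (trn M p q y) = (if p \<in> J s \<and> q \<in> J s then l s p y else 0)"
proof -
  have p: "p \<in> Field r" and q: "q \<in> Field r" using assms(2) by (auto simp: Field_def)
  have "trn M p q y = trn M p q (\<Sum>t\<in>S. scl M (l t p y) (x t p))"
    using expansion[OF p assms(3)] by simp
  also have "\<dots> = (\<Sum>t\<in>S. scl M (l t p y) (trn M p q (x t p)))"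
    using p vec_in by (intro linear_between_sum[OF linear_trn[OF assms(2)] subspace_spc]) auto
  also have "\<dots> = (\<Sum>t\<in>S. scl M (if p \<in> J t then l t p y else 0) (x t q))"
    using assms trn_vec by (intro sum.cong) auto
  finally show ?thesis
    using coordinate_sum[OF assms(1) q] by simp
qed

end

section \<open>Interval bases and the barcode\<close>

definition summands :: "'p set multiset \<Rightarrow> ('p set \<times> nat) set" where
  "summands B = {(I, c). c < count B I}"

lemma finite_summands: "finite (summands B)"
proof -
  have "summands B \<subseteq> Sigma (set_mset B) (\<lambda>I. {..<count B I})"
    unfolding summands_def by (auto simp: not_in_iff intro: ccontr)
  then show ?thesis by (rule finite_subset) auto
qed

lemma card_summands: "card {s \<in> summands B. fst s = I} = count B I"
proof -
  have "{s \<in> summands B. fst s = I} = Pair I ` {..<count B I}"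
    unfolding summands_def by auto
  then show ?thesis by (simp add: card_image inj_on_def)
qed

lemma scl_interval_sum: "scl (interval_sum B) c h = (\<lambda>s. c * h s)"
  unfolding interval_sum_def direct_sum_def interval_module_def by (simp add: case_prod_beta)

lemma spc_interval_sum:
  "h \<in> spc (interval_sum B) p \<longleftrightarrow> (\<forall>s. s \<in> summands B \<and> p \<in> fst s \<or> h s = 0)"
  unfolding interval_sum_def direct_sum_def interval_module_def summands_def[symmetric]
  by (simp add: case_prod_beta del: split_paired_All) (metis singletonD singletonI UNIV_I)

lemma trn_interval_sum:
  "trn (interval_sum B) p q h =
     (\<lambda>s. if s \<in> summands B \<and> p \<in> fst s \<and> q \<in> fst s then h s else 0)"
  unfolding interval_sum_def direct_sum_def interval_module_def summands_def[symmetric]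
  by (auto simp: case_prod_beta)

lemma sum_fun_apply: "(\<Sum>i\<in>A. f i) a = (\<Sum>i\<in>A. f i a :: 'b::comm_monoid_add)"
  by (induction A rule: infinite_finite_induct) simp_all

text \<open>The basis vectors are the preimages of the unit vectors under a given isomorphism, and the
  coordinates are the components of the isomorphism.\<close>

lemma interval_basis_if_decomposes_into:
  fixes M :: "('p, 'k::field, 'v::ab_group_add) persistence"
  assumes "persistence_module r M" and dec: "decomposes_into r M B"
  obtains x l where "interval_basis r M (summands B) fst x l"
proof -
  interpret pmodule r M by unfold_locales fact
  obtain \<phi> where lin: "\<And>p. p \<in> Field r \<Longrightarrow>
      linear_between (scl M) (scl (interval_sum B)) (spc M p) (spc (interval_sum B) p) (\<phi> p)"
    and bij: "\<And>p. p \<in> Field r \<Longrightarrow> bij_betw (\<phi> p) (spc M p) (spc (interval_sum B) p)"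
    and nat: "\<And>p q y. (p, q) \<in> r \<Longrightarrow> y \<in> spc M p \<Longrightarrow>
      \<phi> q (trn M p q y) = trn (interval_sum B) p q (\<phi> p y)"
    using dec unfolding decomposes_into_def persistence_iso_def by blast
  have interval: "is_interval r (fst s)" if "s \<in> summands B" for s
    using dec that unfolding decomposes_into_def summands_def
    by (auto simp: count_greater_zero_iff[symmetric] simp del: count_greater_zero_iff)
  define e :: "'p set \<times> nat \<Rightarrow> 'p set \<times> nat \<Rightarrow> 'k" where "e s = (\<lambda>t. if t = s then 1 else 0)" for s
  define x where "x s p = (if p \<in> fst s then inv_into (spc M p) (\<phi> p) (e s) else 0)" for s p
  define l where "l s p y = \<phi> p y s" for s p y
  have sub: "p \<in> Field r" if "s \<in> summands B" "p \<in> fst s" for s p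
    using interval[OF that(1)] that(2) unfolding is_interval_def by blast
  have e_in: "e s \<in> spc (interval_sum B) p" if "s \<in> summands B" "p \<in> fst s" for s p
    using that unfolding spc_interval_sum e_def by auto
  have x_in: "x s p \<in> spc M p" and \<phi>_x: "\<phi> p (x s p) = e s" if "s \<in> summands B" "p \<in> fst s" for s p
    using bij_betw_imp_surj_on[OF bij[OF sub[OF that]]] e_in[OF that] that(2)
      inv_into_into[of "e s" "\<phi> p" "spc M p"] f_inv_into_f[of "e s" "\<phi> p" "spc M p"]
    by (simp_all add: x_def)
  have \<phi>_zero: "\<phi> p 0 = 0" if "p \<in> Field r" for p
    using linear_between_zero[OF lin subspace_spc] that by blast
  have x_in': "x s p \<in> spc M p" if "s \<in> summands B" "p \<in> Field r" for s p
    using x_in[OF that(1)] zero_in[OF that(2)] by (cases "p \<in> fst s") (auto simp: x_def)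
  have \<phi>_eq: "y = z" if "p \<in> Field r" "y \<in> spc M p" "z \<in> spc M p" "\<phi> p y = \<phi> p z" for p y z
    using bij_betw_imp_inj_on[OF bij[OF that(1)]] that(2-) by (simp add: inj_on_def)
  have "interval_basis r M (summands B) fst x l"
    unfolding interval_basis_def
  proof (intro conjI ballI allI impI, goal_cases)
    case (5 s pq)
    obtain p q where pq: "pq = (p, q)" by force
    have "trn M p q (x s p) = x s q" if p: "p \<in> fst s" and r: "(p, q) \<in> r"
    proof (rule \<phi>_eq)
      show q: "q \<in> Field r" using r by (auto simp: Field_def)
      show "trn M p q (x s p) \<in> spc M q" using trn_in r x_in 5(1) p by blast
      show "x s q \<in> spc M q" using x_in'[OF 5(1) q] .
      have "\<phi> q (x s q) = (if q \<in> fst s then e s else 0)"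
        using \<phi>_x[OF 5(1)] \<phi>_zero[OF q] by (simp add: x_def)
      then show "\<phi> q (trn M p q (x s p)) = \<phi> q (x s q)"
        using nat[OF r x_in[OF 5(1) p]] \<phi>_x[OF 5(1) p] 5(1) p
        by (auto simp: trn_interval_sum fun_eq_iff e_def)
    qed
    then show ?case using 5 pq by auto
  next
    case (6 s p)
    then show ?case
      using lin[OF 6(2)] unfolding linear_between_def l_def scl_interval_sum by auto
  next
    case (7 s t p)
    then show ?case
      using \<phi>_x[OF 7(2)] \<phi>_zero[OF 7(3)] by (auto simp: l_def e_def x_def)
  next
    case (8 p y)
    let ?z = "\<Sum>s\<in>summands B. scl M (l s p y) (x s p)"
    have "\<phi> p ?z = (\<Sum>s\<in>summands B. scl (interval_sum B) (l s p y) (\<phi> p (x s p)))"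
      using x_in'[OF _ 8(1)] by (rule linear_between_sum[OF lin[OF 8(1)] subspace_spc[OF 8(1)]])
    also have "\<dots> = \<phi> p y"
    proof
      fix t
      have "(\<Sum>s\<in>summands B. scl (interval_sum B) (l s p y) (\<phi> p (x s p))) t =
          (\<Sum>s\<in>summands B. if s = t then (if p \<in> fst t then \<phi> p y t else 0) else 0)"
        unfolding sum_fun_apply
      proof (intro sum.cong refl)
        fix s assume s: "s \<in> summands B"
        have "\<phi> p (x s p) = (if p \<in> fst s then e s else 0)"
          using \<phi>_x[OF s] \<phi>_zero[OF 8(1)] by (simp add: x_def)
        then show "scl (interval_sum B) (l s p y) (\<phi> p (x s p)) t =
            (if s = t then (if p \<in> fst t then \<phi> p y t else 0) else 0)"
          by (auto simp: scl_interval_sum l_def e_def)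
      qed
      also have "\<dots> = \<phi> p y t"
      proof -
        have "t \<in> summands B \<and> p \<in> fst t \<or> \<phi> p y t = 0"
          using linear_betweenD(1)[OF lin[OF 8(1)] 8(2)] unfolding spc_interval_sum by blast
        then show ?thesis using finite_summands[of B] by (auto simp: sum.delta)
      qed
      finally show "(\<Sum>s\<in>summands B. scl (interval_sum B) (l s p y) (\<phi> p (x s p))) t = \<phi> p y t" .
    qed
    finally have "\<phi> p ?z = \<phi> p y" .
    moreover have "?z \<in> spc M p"
      using x_in' 8(1) by (intro subspace_sum subspace_scale subspace_spc)
    ultimately show ?case
      using \<phi>_eq[OF 8(1) _ 8(2)] by metis
  qed (use finite_summands interval x_in in \<open>auto simp: x_def\<close>)
  then show ?thesis by (rule that)
qed

lemma count_image_mset_set: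
  assumes "finite S"
  shows "count (image_mset J (mset_set S)) I = card {s \<in> S. J s = I}"
proof -
  have "J -` {I} \<inter> S = {s \<in> S. J s = I}" by auto
  then show ?thesis using assms by (simp add: count_image_mset)
qed

text \<open>Passes from arbitrary indices to the pairs \<open>(I, c)\<close> that number the copies of \<open>I\<close>.\<close>

lemma summands_bijection:
  assumes "finite S"
  obtains \<beta> where "bij_betw \<beta> S (summands (image_mset J (mset_set S)))" "\<And>s. fst (\<beta> s) = J s"
proof -
  let ?B = "image_mset J (mset_set S)"
  have "\<exists>g. bij_betw g {s \<in> S. J s = I} {..<count ?B I}" for I
    using assms by (intro finite_same_card_bij) (auto simp: count_image_mset_set)
  then obtain g where g: "\<And>I. bij_betw (g I) {s \<in> S. J s = I} {..<count ?B I}" by metis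
  have "bij_betw (\<lambda>s. (J s, g (J s) s)) S (summands ?B)"
  proof (rule bij_betw_imageI)
    show "inj_on (\<lambda>s. (J s, g (J s) s)) S"
      using bij_betw_imp_inj_on[OF g] by (auto simp: inj_on_def)
    show "(\<lambda>s. (J s, g (J s) s)) ` S = summands ?B"
    proof (intro equalityI subsetI)
      fix u assume "u \<in> (\<lambda>s. (J s, g (J s) s)) ` S"
      then show "u \<in> summands ?B"
        using bij_betwE[OF g] by (fastforce simp: summands_def)
    next
      fix u assume "u \<in> summands ?B"
      then obtain I c where u: "u = (I, c)" "c < count ?B I" by (auto simp: summands_def)
      then have "c \<in> g I ` {s \<in> S. J s = I}"
        using bij_betw_imp_surj_on[OF g, of I] by blast
      then show "u \<in> (\<lambda>s. (J s, g (J s) s)) ` S" using u by auto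
    qed
  qed
  then show ?thesis using that by fastforce
qed

text \<open>Taking all coordinates of a vector is the required isomorphism.\<close>

lemma (in interval_based) decomposes_into: "decomposes_into r M (image_mset J (mset_set S))"
proof -
  let ?B = "image_mset J (mset_set S)"
  obtain \<beta> where \<beta>: "bij_betw \<beta> S (summands ?B)" and fst_\<beta>: "\<And>s. fst (\<beta> s) = J s"
    using summands_bijection[OF finite_index] by blast
  define \<gamma> where "\<gamma> = inv_into S \<beta>"
  have \<gamma>: "\<gamma> u \<in> S" "\<beta> (\<gamma> u) = u" if "u \<in> summands ?B" for u
    using that \<beta> unfolding \<gamma>_def by (auto simp: bij_betw_def inv_into_into f_inv_into_f)
  have \<gamma>_\<beta>: "\<gamma> (\<beta> s) = s" if "s \<in> S" for s
    using that \<beta> by (auto simp: \<gamma>_def bij_betw_def inv_into_f_f)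
  have J_\<gamma>: "J (\<gamma> u) = fst u" if "u \<in> summands ?B" for u
    using \<gamma>(2)[OF that] fst_\<beta>[of "\<gamma> u"] by simp
  define \<phi> where "\<phi> p y = (\<lambda>u. if u \<in> summands ?B then l (\<gamma> u) p y else 0)" for p y
  have lin: "linear_between (scl M) (scl (interval_sum ?B)) (spc M p) (spc (interval_sum ?B) p) (\<phi> p)"
    if p: "p \<in> Field r" for p
  proof -
    have "l (\<gamma> u) p y = 0" if "u \<in> summands ?B" "y \<in> spc M p" "p \<notin> fst u" for u y
      using that \<gamma>(1) J_\<gamma> coordinate_outside p by metis
    then have "\<phi> p y \<in> spc (interval_sum ?B) p" if "y \<in> spc M p" for y
      using that unfolding spc_interval_sum \<phi>_def by metis
    then show ?thesis
      using linear_betweenD[OF functional[OF \<gamma>(1) p]]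
      unfolding linear_between_def image_subset_iff
      by (simp add: scl_interval_sum \<phi>_def fun_eq_iff)
  qed
  have bij: "bij_betw (\<phi> p) (spc M p) (spc (interval_sum ?B) p)" if p: "p \<in> Field r" for p
  proof (rule bij_betw_imageI)
    show "inj_on (\<phi> p) (spc M p)"
    proof (rule inj_onI)
      fix y z assume yz: "y \<in> spc M p" "z \<in> spc M p" "\<phi> p y = \<phi> p z"
      have "l s p y = l s p z" if "s \<in> S" for s
        using fun_cong[OF yz(3), of "\<beta> s"] bij_betwE[OF \<beta>] that \<gamma>_\<beta> by (simp add: \<phi>_def)
      then have "(\<Sum>s\<in>S. scl M (l s p y) (x s p)) = (\<Sum>s\<in>S. scl M (l s p z) (x s p))" by simp
      then show "y = z" using expansion p yz(1,2) by simp
    qed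
    have "h \<in> \<phi> p ` spc M p" if h: "h \<in> spc (interval_sum ?B) p" for h
    proof
      let ?y = "\<Sum>s\<in>S. scl M (h (\<beta> s)) (x s p)"
      show "?y \<in> spc M p"
        using vec_in p by (intro subspace_sum subspace_scale subspace_spc) auto
      show "h = \<phi> p ?y"
      proof
        fix u
        have "u \<in> summands ?B \<and> p \<in> fst u \<or> h u = 0"
          using h unfolding spc_interval_sum by blast
        then show "h u = \<phi> p ?y u"
          using coordinate_sum[OF \<gamma>(1) p, of u "\<lambda>s. h (\<beta> s)"] \<gamma>(2)[of u] J_\<gamma>[of u]
          by (auto simp: \<phi>_def)
      qed
    qed
    then show "\<phi> p ` spc M p = spc (interval_sum ?B) p"
      using linear_betweenD(1)[OF lin[OF p]] by blast
  qed
  have "\<phi> q (trn M p q y) = trn (interval_sum ?B) p q (\<phi> p y)" if "(p, q) \<in> r" "y \<in> spc M p" for p q y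
    using coordinate_trn[OF \<gamma>(1) that] J_\<gamma> by (auto simp: \<phi>_def trn_interval_sum)
  with lin bij have "persistence_iso r M (interval_sum ?B)"
    unfolding persistence_iso_def by (intro exI[of _ \<phi>]) blast
  then show ?thesis
    using interval finite_index unfolding decomposes_into_def by auto
qed

section \<open>Uniqueness of the barcode\<close>

text \<open>
  The entries \<open>u t p (x s p)\<close> and \<open>l s' p (y t' p)\<close> of the two base change matrices describe maps
  from the interval module of \<open>J s\<close> to that of \<open>K t\<close> and back. Where both are nonzero, naturality
  carries this along every comparability inside \<open>J s\<close>, and hence, by connectedness, to all of
  \<open>J s\<close>.
\<close>

lemma interval_subset_if_base_change_nonzero:
  assumes "interval_based r M S J x l" "interval_based r M T K y u"
    and s: "s \<in> S" "s' \<in> S" "J s' = J s" and t: "t \<in> T" "t' \<in> T" "K t' = K t"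
    and p: "p \<in> J s" and nz: "u t p (x s p) \<noteq> 0" "l s' p (y t' p) \<noteq> 0"
  shows "J s \<subseteq> K t"
proof
  interpret A: interval_based r M S J x l by fact
  interpret B: interval_based r M T K y u by fact
  let ?R = "Restr (r \<union> r\<inverse>) (J s)"
  have K: "q \<in> K t" if "u t q (x s q) \<noteq> 0" "q \<in> J s" for q
    using that B.coordinate_outside[OF t(1)] A.vec_in[OF s(1)] A.interval_Field[OF s(1)] by blast
  have step: "u t q' (x s q') \<noteq> 0 \<and> l s' q' (y t' q') \<noteq> 0"
    if R: "(q, q') \<in> ?R" and "u t q (x s q) \<noteq> 0 \<and> l s' q (y t' q) \<noteq> 0" for q q'
  proof -
    have q: "q \<in> J s" "q' \<in> J s" "q \<in> K t" "q \<in> Field r" "q' \<in> Field r"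
      using R that K A.interval_Field[OF s(1)] by auto
    consider "(q, q') \<in> r" | "(q', q) \<in> r" using R by auto
    then show ?thesis
    proof cases
      case 1
      have "l s' q' (y t' q') = l s' q (y t' q)"
        using A.coordinate_trn[OF s(2) 1 B.vec_in[OF t(2)]] B.trn_vec[OF t(2) 1] q s(3) t(3) by simp
      moreover from this have "q' \<in> K t"
        using that B.vec_zero[OF t(2)] q(5) t(3) A.linear_between_zero[OF A.functional[OF s(2)] A.subspace_spc]
        by metis
      moreover have "u t q' (x s q') = (if q' \<in> K t then u t q (x s q) else 0)"
        using B.coordinate_trn[OF t(1) 1 A.vec_in[OF s(1)]] A.trn_vec[OF s(1) 1] q by simp
      ultimately show ?thesis using that by simp
    next
      case 2
      have "u t q (x s q) = (if q' \<in> K t then u t q' (x s q') else 0)"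
        using B.coordinate_trn[OF t(1) 2 A.vec_in[OF s(1)]] A.trn_vec[OF s(1) 2] q by simp
      moreover from this have "q' \<in> K t" using that by metis
      moreover from this have "l s' q (y t' q) = l s' q' (y t' q')"
        using A.coordinate_trn[OF s(2) 2 B.vec_in[OF t(2)]] B.trn_vec[OF t(2) 2] q s(3) t(3) by simp
      ultimately show ?thesis using that by simp
    qed
  qed
  fix q assume q: "q \<in> J s"
  have "(p, q) \<in> ?R\<^sup>*"
    using A.interval[OF s(1)] p q unfolding is_interval_def by blast
  then have "u t q (x s q) \<noteq> 0 \<and> l s' q (y t' q) \<noteq> 0"
    by induction (use nz step in blast)+
  then show "q \<in> K t" using K q by blast
qed

text \<open>
  The preceding lemma, applied in both directions, shows that a composite through an interval
  \<open>K t\<close> other than \<open>I\<close> vanishes. So at a point of \<open>I\<close> the block \<open>u t p (x s p)\<close> with \<open>J s = K t = I\<close>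
  has a left inverse, and it cannot have fewer rows than columns.
\<close>

lemma interval_basis_card_le:
  assumes "interval_based r M S J x l" "interval_based r M T K y u"
  shows "card {s \<in> S. J s = I} \<le> card {t \<in> T. K t = I}"
proof (cases "{s \<in> S. J s = I} = {}")
  case False
  interpret A: interval_based r M S J x l by fact
  interpret B: interval_based r M T K y u by fact
  let ?S = "{s \<in> S. J s = I}" and ?T = "{t \<in> T. K t = I}"
  obtain p where p: "p \<in> I" "p \<in> Field r"
    using False A.interval A.interval_Field unfolding is_interval_def by blast
  have zero: "u t p (x s p) * l s' p (y t p) = 0"
    if "s \<in> ?S" "s' \<in> ?S" "t \<in> T" "K t \<noteq> I" for s s' t
  proof (rule ccontr)
    assume "u t p (x s p) * l s' p (y t p) \<noteq> 0"
    then have nz: "u t p (x s p) \<noteq> 0" "l s' p (y t p) \<noteq> 0" by auto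
    then have "p \<in> K t"
      using B.coordinate_outside[OF that(3) p(2)] A.vec_in[OF _ p(2)] that(1) by blast
    then have "J s \<subseteq> K t" "K t \<subseteq> J s'"
      using interval_subset_if_base_change_nonzero[OF assms, of s s' t t p]
        interval_subset_if_base_change_nonzero[OF assms(2,1), of t t s' s p] that nz p by auto
    then show False using that by auto
  qed
  define x' where "x' s = (\<Sum>t\<in>?T. scl M (u t p (x s p)) (y t p))" for s
  have dual: "l s' p (x' s) = (if s' = s then 1 else 0)" if s: "s \<in> ?S" "s' \<in> ?S" for s s'
  proof -
    have "l s' p (x' s) = (\<Sum>t\<in>?T. u t p (x s p) * l s' p (y t p))"
      unfolding x'_def using s p B.vec_in
      by (intro A.linear_between_sum[OF A.functional A.subspace_spc]) auto
    also have "\<dots> = (\<Sum>t\<in>T. u t p (x s p) * l s' p (y t p))"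
      using zero[OF s] B.finite_index by (intro sum.mono_neutral_left) auto
    also have "\<dots> = l s' p (\<Sum>t\<in>T. scl M (u t p (x s p)) (y t p))"
      using s p B.vec_in
      by (intro A.linear_between_sum[OF A.functional A.subspace_spc, symmetric]) auto
    also have "\<dots> = l s' p (x s p)"
      using B.expansion[OF p(2)] A.vec_in p(2) s by simp
    finally show ?thesis using A.dual s p by auto
  qed
  have "card ?S \<le> card ((\<lambda>t. y t p) ` ?T)"
  proof (rule A.card_le_if_dual_family[where x = x' and V = "spc M p" and l = "\<lambda>s. l s p"])
    show "finite ?S" "finite ((\<lambda>t. y t p) ` ?T)" using A.finite_index B.finite_index by auto
    show "x' s \<in> A.span ((\<lambda>t. y t p) ` ?T)" for s
      unfolding x'_def by (intro A.span_sum A.span_scale A.span_base) auto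
    show "x' s \<in> spc M p" for s
      unfolding x'_def using B.vec_in p
      by (intro A.subspace_sum A.subspace_scale A.subspace_spc) auto
  qed (use p A.subspace_spc A.functional dual in auto)
  also have "\<dots> \<le> card ?T"
    using B.finite_index by (intro card_image_le) auto
  finally show ?thesis .
next
  case True
  then show ?thesis by (metis card.empty le0)
qed

text \<open>Any decomposition yields an interval basis, and two interval bases have equally many summands
  of each type, so the description of the barcode picks out the decomposition at hand.\<close>

theorem interval_mult_interval_basis:
  assumes "persistence_module r M" "interval_basis r M S J x l"
  shows "interval_mult r M I = card {s \<in> S. J s = I}"
proof -
  interpret interval_based r M S J x l
    using assms by unfold_locales
  let ?B = "image_mset J (mset_set S)"
  have unique: "B = ?B" if dec: "decomposes_into r M B" for B
  proof (rule multiset_eqI)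
    fix I
    obtain y u where "interval_basis r M (summands B) fst y u"
      by (rule interval_basis_if_decomposes_into[OF assms(1) dec])
    then have other: "interval_based r M (summands B) fst y u"
      using assms by unfold_locales
    have "card {s \<in> S. J s = I} = card {s \<in> summands B. fst s = I}"
      using interval_basis_card_le[OF interval_based_axioms other]
        interval_basis_card_le[OF other interval_based_axioms] by (rule order_antisym)
    then show "count B I = count ?B I"
      by (simp add: card_summands count_image_mset_set finite_index)
  qed
  then have "barcode r M = ?B"
    unfolding barcode_def using the_equality[of "decomposes_into r M", OF decomposes_into] unique by blast
  then show ?thesis
    by (simp add: interval_mult_def count_image_mset_set finite_index)
qed

section \<open>Splitting off interval summands\<close>

context pmodule
begin

lemma spc_basis:
  assumes p: "p \<in> Field r"
  obtains Z where "finite Z" "independent Z" "span Z = spc M p" "dim (spc M p) = card Z"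
proof -
  obtain Z where Z: "Z \<subseteq> spc M p" "independent Z" "spc M p \<subseteq> span Z"
    by (rule maximal_independent_subset)
  obtain Y where Y: "finite Y" "span Y = spc M p"
    using finitely_spanned[OF p] by auto
  have "finite Z"
    using independent_span_bound[OF Y(1) Z(2)] Z(1) Y(2) by fastforce
  moreover have "span Z = spc M p"
    using Z span_minimal[OF _ subspace_spc[OF p]] by blast
  ultimately show ?thesis
    using that Z(2) dim_span_eq_card_independent[OF Z(2)] by simp
qed

text \<open>The vectors \<open>x p\<close> are the image of the generator under a map from the interval module of \<open>I\<close>
  to \<open>M\<close>, and \<open>f\<close> is a map back; the equation \<open>f p (x p) = 1\<close> makes the composite the identity.
  Thus \<open>M\<close> is the sum of a copy of the interval module and the kernel of \<open>f\<close>.\<close>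

definition interval_summand :: "'p set \<Rightarrow> ('p \<Rightarrow> 'v) \<Rightarrow> ('p \<Rightarrow> 'v \<Rightarrow> 'k) \<Rightarrow> bool" where
  "interval_summand I x f \<longleftrightarrow>
     is_interval r I \<and>
     (\<forall>p\<in>I. x p \<in> spc M p \<and> functional_on p (f p) \<and> f p (x p) = 1) \<and>
     (\<forall>p q. (p, q) \<in> r \<longrightarrow> p \<in> I \<longrightarrow> trn M p q (x p) = (if q \<in> I then x q else 0)) \<and>
     (\<forall>p q y. (p, q) \<in> r \<longrightarrow> q \<in> I \<longrightarrow> y \<in> spc M p \<longrightarrow>
        f q (trn M p q y) = (if p \<in> I then f p y else 0))"

end

definition kernel_module ::
  "('p, 'k::field, 'v) persistence \<Rightarrow> 'p set \<Rightarrow> ('p \<Rightarrow> 'v \<Rightarrow> 'k) \<Rightarrow> ('p, 'k, 'v) persistence"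
where
  "kernel_module M I f = M\<lparr>spc := (\<lambda>p. {y \<in> spc M p. p \<in> I \<longrightarrow> f p y = 0})\<rparr>"

locale split_summand = pmodule r M
  for r :: "('p \<times> 'p) set" and M :: "('p, 'k::field, 'v::ab_group_add) persistence" +
  fixes I x f
  assumes summand: "interval_summand I x f"
begin

abbreviation "N \<equiv> kernel_module M I f"

lemma kernel_simps [simp]:
  "scl N = scl M" "trn N = trn M"
  "y \<in> spc N p \<longleftrightarrow> y \<in> spc M p \<and> (p \<in> I \<longrightarrow> f p y = 0)"
  by (simp_all add: kernel_module_def)

lemma sub_Field: "p \<in> I \<Longrightarrow> p \<in> Field r"
  using summand unfolding interval_summand_def is_interval_def by blast

lemma summandD:
  assumes "p \<in> I"
  shows "x p \<in> spc M p" "functional_on p (f p)" "f p (x p) = 1"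
  using assms summand unfolding interval_summand_def by auto

lemma trn_summand: "(p, q) \<in> r \<Longrightarrow> p \<in> I \<Longrightarrow> trn M p q (x p) = (if q \<in> I then x q else 0)"
  using summand unfolding interval_summand_def by blast

lemma summand_trn:
  "(p, q) \<in> r \<Longrightarrow> q \<in> I \<Longrightarrow> y \<in> spc M p \<Longrightarrow> f q (trn M p q y) = (if p \<in> I then f p y else 0)"
  using summand unfolding interval_summand_def by blast

lemma kernel_subspace: assumes p: "p \<in> Field r" shows "subspace (spc N p)"
proof (cases "p \<in> I")
  case True
  show ?thesis
    using subspace_spc[OF p] linear_between_zero[OF summandD(2)[OF True] subspace_spc[OF p]] True
    unfolding subspace_def by (simp add: linear_betweenD[OF summandD(2)[OF True]])
next
  case False
  then show ?thesis
    using subspace_spc[OF p] unfolding subspace_def by simp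
qed

lemma kernel_basis:
  assumes p: "p \<in> Field r"
  shows "\<exists>X. finite X \<and> independent X \<and> span X = spc N p"
proof -
  obtain X where X: "X \<subseteq> spc N p" "independent X" "spc N p \<subseteq> span X"
    by (rule maximal_independent_subset)
  obtain Y where Y: "finite Y" "span Y = spc M p"
    using finitely_spanned[OF p] by auto
  have "finite X"
    using independent_span_bound[OF Y(1) X(2)] X(1) Y(2) by fastforce
  moreover have "span X = spc N p"
    using X(1,3) span_minimal[OF _ kernel_subspace[OF p]] by blast
  ultimately show ?thesis using X(2) by blast
qed

lemma kernel_persistence_module: "persistence_module r N"
  unfolding persistence_module_def
proof (intro conjI ballI allI impI, goal_cases)
  case 1 show ?case using vector_space_axioms by simp
next
  case (2 p) then show ?case using kernel_subspace by simp
next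
  case (3 p) then show ?case using kernel_basis[of p] by auto
next
  case (4 pq)
  obtain p q where pq: "pq = (p, q)" by force
  with 4 have r: "(p, q) \<in> r" by simp
  have "trn M p q y \<in> spc N q" if "y \<in> spc N p" for y
    using that trn_in[OF r] summand_trn[OF r] by auto
  then show ?case
    using linear_betweenD[OF linear_trn[OF r]] unfolding pq linear_between_def by auto
next
  case (5 p y) then show ?case using trn_id by simp
next
  case (6 p q s y) then show ?case using trn_trn by simp
qed

lemma dim_kernel_le: assumes p: "p \<in> Field r" shows "dim (spc N p) \<le> dim (spc M p)"
proof -
  obtain X where X: "finite X" "independent X" "span X = spc N p"
    using kernel_basis[OF p] by auto
  obtain Z where Z: "finite Z" "independent Z" "span Z = spc M p" "dim (spc M p) = card Z"
    by (rule spc_basis[OF p])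
  have "dim (spc N p) = card X"
    using dim_span_eq_card_independent[OF X(2)] X(3) by simp
  also have "\<dots> \<le> card Z"
    using independent_span_bound[OF Z(1) X(2)] X(3) Z(3) span_superset[of X] by fastforce
  finally show ?thesis using Z(4) by simp
qed

lemma dim_kernel_less: assumes p: "p \<in> I" shows "dim (spc N p) < dim (spc M p)"
proof -
  obtain X where X: "finite X" "independent X" "span X = spc N p"
    using kernel_basis[OF sub_Field[OF p]] by auto
  obtain Z where Z: "finite Z" "independent Z" "span Z = spc M p" "dim (spc M p) = card Z"
    by (rule spc_basis[OF sub_Field[OF p]])
  have x: "x p \<notin> span X"
    using X(3) summandD(3)[OF p] p by simp
  then have notin: "x p \<notin> X"
    using span_base by blast
  have "insert (x p) X \<subseteq> span Z"
    using summandD(1)[OF p] Z(3) X(3) span_superset[of X] by auto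
  then have "card (insert (x p) X) \<le> card Z"
    using independent_span_bound[OF Z(1) independent_insertI[OF x X(2)]] by blast
  then show ?thesis
    using dim_span_eq_card_independent[OF X(2)] X(1,3) Z(4) notin by simp
qed

text \<open>The coordinates of the complement are extended to all of \<open>M\<close> by composing them with the
  projection that sends \<open>y\<close> to \<open>y - f p y \<cdot> x p\<close>.\<close>

lemma extend_interval_basis:
  assumes N: "interval_basis r N S J z l" and new: "s0 \<notin> S"
  shows "\<exists>J' z' l'. interval_basis r M (insert s0 S) J' z' l'"
proof -
  interpret N: interval_based r N S J z l
    using kernel_persistence_module N by unfold_locales
  define pr where "pr p y = (if p \<in> I then y - scl M (f p y) (x p) else y)" for p y
  define z' where "z' s p = (if s = s0 then if p \<in> I then x p else 0 else z s p)" for s p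
  define l' where "l' s p y =
    (if s = s0 then if p \<in> I then f p y else 0 else l s p (pr p y))" for s p y
  have pr_in: "pr p y \<in> spc N p" if "p \<in> Field r" "y \<in> spc M p" for p y
    using that summandD[of p] linear_between_diff[OF summandD(2) subspace_spc]
    by (auto simp: pr_def intro!: subspace_diff subspace_scale subspace_spc)
  have pr_N: "pr p y = y" if "p \<in> Field r" "y \<in> spc N p" for p y
    using that by (auto simp: pr_def)
  have pr_x: "pr p (x p) = 0" if "p \<in> I" for p
    using that summandD(3) by (simp add: pr_def)
  have pr_linear: "linear_between (scl M) (scl N) (spc M p) (spc N p) (pr p)" if p: "p \<in> Field r" for p
  proof (cases "p \<in> I")
    case True
    note f = linear_betweenD[OF summandD(2)[OF True]]
    show ?thesis
      unfolding linear_between_def image_subset_iff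
      using pr_in[OF p] by (simp add: f pr_def True algebra_simps)
  next
    case False
    then show ?thesis
      unfolding linear_between_def image_subset_iff
      using pr_in[OF p] by (simp add: pr_def)
  qed
  have z_N: "z s p \<in> spc N p" if "s \<in> S" "p \<in> Field r" for s p
    using N.vec_in that by blast
  have neq: "s \<noteq> s0" if "s \<in> S" for s using new that by auto
  have l_zero: "l s p 0 = 0" if "s \<in> S" "p \<in> Field r" for s p
    using N.linear_between_zero[OF N.functional[OF that] N.subspace_spc[OF that(2)]] .
  have "interval_basis r M (insert s0 S) (\<lambda>s. if s = s0 then I else J s) z' l'"
    unfolding interval_basis_def
  proof (intro conjI ballI allI impI, goal_cases)
    case 1 show ?case using N.finite_index by simp
  next
    case (2 s) then show ?case
      using N.interval summand unfolding interval_summand_def by auto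
  next
    case (3 s p) then show ?case
      using summandD(1) z_N N.interval_Field neq by (auto simp: z'_def split: if_splits)
  next
    case (4 s p) then show ?case
      using N.vec_zero neq by (auto simp: z'_def split: if_splits)
  next
    case (5 s pq) then show ?case
      using N.trn_vec neq trn_summand by (auto simp: z'_def split: if_splits)
  next
    case (6 s p)
    show ?case
    proof (cases "s = s0")
      case True
      then show ?thesis using summandD(2) by (auto simp: l'_def linear_between_def)
    next
      case False
      then have "linear_between (scl M) (*) (spc M p) UNIV (\<lambda>y. l s p (pr p y))"
        using 6 linear_between_comp[OF pr_linear N.functional] by auto
      moreover have "l' s p = (\<lambda>y. l s p (pr p y))"
        using False by (simp add: l'_def fun_eq_iff)
      ultimately show ?thesis by simp
    qed
  next
    case (7 s t p)
    then show ?case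
      using N.dual[of s t p] z_N[of t p] pr_N[OF 7(3), of "z t p"] pr_x[of p] summandD(3)[of p] new l_zero[of s p]
        summandD(2)[of p] linear_between_zero[OF summandD(2) subspace_spc, of p]
      by (auto simp: z'_def l'_def pr_def)
  next
    case (8 p y)
    have "(\<Sum>s\<in>insert s0 S. scl M (l' s p y) (z' s p)) =
        (if p \<in> I then scl M (f p y) (x p) else 0) + (\<Sum>s\<in>S. scl M (l' s p y) (z' s p))"
      using new N.finite_index by (simp add: l'_def z'_def)
    also have "(\<Sum>s\<in>S. scl M (l' s p y) (z' s p)) = (\<Sum>s\<in>S. scl N (l s p (pr p y)) (z s p))"
      using neq by (intro sum.cong) (auto simp: l'_def z'_def)
    also have "\<dots> = pr p y"
      by (rule N.expansion[OF 8(1) pr_in[OF 8]])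
    finally show ?case by (simp add: pr_def)
  qed
  then show ?thesis by blast
qed

end

text \<open>Induction on the total dimension: the kernel of a split summand is smaller at every point of
  the interval. The index type is infinite, so a fresh index for the new summand exists.\<close>

theorem interval_basis_exists:
  fixes M :: "('p, 'k::field, 'v::ab_group_add) persistence"
  assumes "finite (Field r)" and "persistence_module r M"
    and split: "\<And>N :: ('p, 'k, 'v) persistence. persistence_module r N \<Longrightarrow>
      \<exists>p\<in>Field r. spc N p \<noteq> {0} \<Longrightarrow> \<exists>I x f. pmodule.interval_summand r N I x f"
  shows "\<exists>(S :: nat set) J x l. interval_basis r M S J x l"
  using assms(2)
proof (induction "\<Sum>p\<in>Field r. vector_space.dim (scl M) (spc M p)" arbitrary: M rule: less_induct)
  case less
  interpret pmodule r M by unfold_locales fact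
  show ?case
  proof (cases "\<exists>p\<in>Field r. spc M p \<noteq> {0}")
    case True
    then obtain I x f where "interval_summand I x f"
      using split[OF less.prems] by blast
    then interpret split_summand r M I x f by unfold_locales
    obtain p where p: "p \<in> I"
      using summand unfolding interval_summand_def is_interval_def by blast
    have "(\<Sum>p\<in>Field r. vector_space.dim (scl N) (spc N p)) <
        (\<Sum>p\<in>Field r. vector_space.dim (scl M) (spc M p))"
      using dim_kernel_le dim_kernel_less[OF p] sub_Field[OF p] assms(1)
      by (auto intro!: sum_strict_mono_ex1)
    then obtain S :: "nat set" and J z l where N: "interval_basis r N S J z l"
      using less.hyps kernel_persistence_module by blast
    then have "finite S" unfolding interval_basis_def by blast
    then obtain s0 where "s0 \<notin> S" using ex_new_if_finite infinite_UNIV_nat by blast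
    then show ?thesis using extend_interval_basis[OF N] by blast
  next
    case False
    then have "interval_basis r M ({} :: nat set) J x l" for J x l
      unfolding interval_basis_def by simp
    then show ?thesis by blast
  qed
qed

section \<open>Modules over two chains with common ends\<close>

lemma is_intervalI:
  assumes "I \<subseteq> Field r" and e: "e \<in> I"
    and cone: "\<And>x. x \<in> I \<Longrightarrow> (x, e) \<in> r \<or> (e, x) \<in> r"
    and convex: "\<And>x y z. x \<in> I \<Longrightarrow> z \<in> I \<Longrightarrow> (x, y) \<in> r \<Longrightarrow> (y, z) \<in> r \<Longrightarrow> y \<in> I"
  shows "is_interval r I"
proof -
  have "(x, e) \<in> Restr (r \<union> r\<inverse>) I" "(e, x) \<in> Restr (r \<union> r\<inverse>) I" if "x \<in> I" for x
    using that cone[OF that] e by auto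
  then have "(x, y) \<in> (Restr (r \<union> r\<inverse>) I)\<^sup>*" if "x \<in> I" "y \<in> I" for x y
    using that by (meson r_into_rtrancl rtrancl_trans)
  then show ?thesis
    using assms(1) e convex unfolding is_interval_def by blast
qed

text \<open>
  The bipath poset up to the names of its elements: two chains \<open>t 0 < \<dots> < t a\<close> and
  \<open>b 0 < \<dots> < b d\<close> that share exactly their ends. The description is symmetric in the chains, so
  statements about one of them hold for the other by interpretation.
\<close>

locale two_chains =
  fixes r :: "('p \<times> 'p) set" and t b :: "nat \<Rightarrow> 'p" and a d :: nat
  assumes r_eq: "r = {(t i, t j) | i j. i \<le> j \<and> j \<le> a} \<union> {(b i, b j) | i j. i \<le> j \<and> j \<le> d}"
    and inj_t: "inj_on t {..a}" and inj_b: "inj_on b {..d}"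
    and pos: "0 < a" "0 < d" and bot: "b 0 = t 0" and top: "b d = t a"
    and meet: "i \<le> a \<Longrightarrow> j \<le> d \<Longrightarrow> t i = b j \<Longrightarrow> i = 0 \<and> j = 0 \<or> i = a \<and> j = d"
begin

lemma swap: "two_chains r b t d a"
proof
  show "inj_on b {..d}" "inj_on t {..a}" by (fact inj_b inj_t)+
  show "i = 0 \<and> j = 0 \<or> i = d \<and> j = a" if "i \<le> d" "j \<le> a" "b i = t j" for i j
    using meet[of j i] that by auto
qed (use r_eq pos bot top in auto)

lemma le_t: "i \<le> j \<Longrightarrow> j \<le> a \<Longrightarrow> (t i, t j) \<in> r"
  unfolding r_eq by blast

lemma le_b: "i \<le> j \<Longrightarrow> j \<le> d \<Longrightarrow> (b i, b j) \<in> r"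
  unfolding r_eq by blast

lemma in_Field: "i \<le> a \<Longrightarrow> t i \<in> Field r" "j \<le> d \<Longrightarrow> b j \<in> Field r"
  using le_t[of i i] le_b[of j j] by (auto simp: Field_def)

lemma Field_cases:
  assumes "p \<in> Field r"
  obtains k where "k \<le> a" "p = t k" | k where "k \<le> d" "p = b k"
proof -
  obtain q where "(p, q) \<in> r \<or> (q, p) \<in> r" using assms by (auto simp: Field_def)
  then have "(\<exists>k\<le>a. p = t k) \<or> (\<exists>k\<le>d. p = b k)"
    unfolding r_eq using le_trans by blast
  then show ?thesis using that by blast
qed

lemma le_t_iff: "i \<le> a \<Longrightarrow> j \<le> a \<Longrightarrow> (t i, t j) \<in> r \<longleftrightarrow> i \<le> j"
proof
  assume ij: "i \<le> a" "j \<le> a" "(t i, t j) \<in> r"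
  then consider i' j' where "i' \<le> j'" "j' \<le> a" "t i = t i'" "t j = t j'"
    | i' j' where "i' \<le> j'" "j' \<le> d" "t i = b i'" "t j = b j'"
    unfolding r_eq by blast
  then show "i \<le> j"
  proof cases
    case 1
    then show ?thesis using ij inj_onD[OF inj_t, of i i'] inj_onD[OF inj_t, of j j'] by auto
  next
    case 2
    then show ?thesis using ij pos meet[of i i'] meet[of j j'] by auto
  qed
qed (rule le_t)

lemma t_le_b_iff:
  assumes "i \<le> a" "j < d" shows "(t i, b j) \<in> r \<longleftrightarrow> i = 0"
proof
  assume "(t i, b j) \<in> r"
  then consider i' j' where "i' \<le> j'" "j' \<le> a" "t i = t i'" "b j = t j'"
    | i' j' where "i' \<le> j'" "j' \<le> d" "t i = b i'" "b j = b j'"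
    unfolding r_eq by blast
  then show "i = 0"
  proof cases
    case 1
    then show ?thesis using assms inj_onD[OF inj_t, of i i'] meet[of j' j] by auto
  next
    case 2
    then show ?thesis using assms inj_onD[OF inj_b, of j j'] meet[of i i'] by auto
  qed
next
  assume "i = 0"
  then show "(t i, b j) \<in> r" using le_b[of 0 j] assms bot by simp
qed

lemma b_le_t_iff:
  assumes "i \<le> a" "0 < j" "j \<le> d" shows "(b j, t i) \<in> r \<longleftrightarrow> i = a"
proof
  assume "(b j, t i) \<in> r"
  then consider i' j' where "i' \<le> j'" "j' \<le> a" "b j = t i'" "t i = t j'"
    | i' j' where "i' \<le> j'" "j' \<le> d" "b j = b i'" "t i = b j'"
    unfolding r_eq by blast
  then show "i = a"
  proof cases
    case 1
    then show ?thesis using assms inj_onD[OF inj_t, of i j'] meet[of i' j] by auto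
  next
    case 2
    then show ?thesis using assms inj_onD[OF inj_b, of j i'] meet[of i j'] by auto
  qed
next
  assume "i = a"
  then show "(b j, t i) \<in> r" using le_b[of j d] assms top by simp
qed

lemma bot_least: "p \<in> Field r \<Longrightarrow> (t 0, p) \<in> r"
  by (erule Field_cases) (use le_t[of 0] le_b[of 0] bot in auto)

lemma top_greatest: "p \<in> Field r \<Longrightarrow> (p, t a) \<in> r"
  by (erule Field_cases) (use le_t[of _ a] le_b[of _ d] top in auto)

lemma trans_t:
  assumes "i \<le> j" "j \<le> a" "(t j, q) \<in> r"
  shows "(t i, q) \<in> r"
proof -
  have "q \<in> Field r" using assms by (auto simp: Field_def)
  then show ?thesis
  proof (cases rule: Field_cases)
    case (1 k) then show ?thesis using assms le_t_iff[of j k] le_t[of i k] by auto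
  next
    case (2 k)
    show ?thesis
    proof (cases "k = d")
      case True
      then show ?thesis using 2 assms le_t[of i a] top by auto
    next
      case False
      then show ?thesis using 2 assms t_le_b_iff[of j k] by auto
    qed
  qed
qed

end

sublocale two_chains \<subseteq> swap: two_chains r b t d a
  by (rule swap)

context two_chains
begin

lemma trans: assumes "(p, q) \<in> r" "(q, s) \<in> r" shows "(p, s) \<in> r"
  using assms(1) trans_t swap.trans_t assms(2) unfolding r_eq[THEN eqset_imp_iff, of "(p, q)"] by auto

text \<open>The next four facts describe the complements of the left intervals
  \<open>{p. p \<le> t i \<or> p \<le> b j}\<close> and of the right intervals \<open>{p. t (i + 1) \<le> p \<or> b (j + 1) \<le> p}\<close>, and
  the overlap of the two branches of such an interval.\<close>

lemma not_below_left:
  assumes "i < a" "j < d" "q \<in> Field r" "(q, t i) \<notin> r" "(q, b j) \<notin> r"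
  shows "(t (Suc i), q) \<in> r \<or> (b (Suc j), q) \<in> r"
  using assms(3)
proof (cases rule: Field_cases)
  case (1 k) then show ?thesis using assms le_t[of k i] le_t[of "Suc i" k] by fastforce
next
  case (2 k) then show ?thesis using assms le_b[of k j] le_b[of "Suc j" k] by fastforce
qed

lemma below_both:
  assumes "i < a" "j < d" "(p, t i) \<in> r" "(p, b j) \<in> r"
  shows "p = t 0"
proof -
  have "p \<in> Field r" using assms by (auto simp: Field_def)
  then show ?thesis
  proof (cases rule: Field_cases)
    case (1 k) then show ?thesis using assms t_le_b_iff[of k j] by auto
  next
    case (2 k) then show ?thesis using assms swap.t_le_b_iff[of k i] bot by auto
  qed
qed

lemma not_above_right:
  assumes "i < a" "j < d" "q \<in> Field r" "(t (Suc i), q) \<notin> r" "(b (Suc j), q) \<notin> r"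
  shows "(q, t i) \<in> r \<or> (q, b j) \<in> r"
  using assms(3)
proof (cases rule: Field_cases)
  case (1 k) then show ?thesis using assms le_t[of k i] le_t[of "Suc i" k] by fastforce
next
  case (2 k) then show ?thesis using assms le_b[of k j] le_b[of "Suc j" k] by fastforce
qed

lemma above_both:
  assumes "i < a" "j < d" "(t (Suc i), p) \<in> r" "(b (Suc j), p) \<in> r"
  shows "p = t a"
proof -
  have "p \<in> Field r" using assms by (auto simp: Field_def)
  then show ?thesis
  proof (cases rule: Field_cases)
    case (1 k) then show ?thesis using assms b_le_t_iff[of k "Suc j"] by auto
  next
    case (2 k) then show ?thesis using assms swap.b_le_t_iff[of k "Suc i"] top by auto
  qed
qed

lemma below_t:
  assumes "(q, t j) \<in> r" "j < a"
  obtains k where "k \<le> j" "q = t k"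
proof -
  have "q \<in> Field r" using assms by (auto simp: Field_def)
  then show ?thesis
  proof (cases rule: Field_cases)
    case (1 k) then show ?thesis using that assms le_t_iff[of k j] by auto
  next
    case (2 k) then show ?thesis using that[of 0] assms swap.t_le_b_iff[of k j] bot by auto
  qed
qed

lemma above_t:
  assumes "(t i, q) \<in> r" "0 < i" "i \<le> a"
  obtains k where "i \<le> k" "k \<le> a" "q = t k"
proof -
  have "q \<in> Field r" using assms by (auto simp: Field_def)
  then show ?thesis
  proof (cases rule: Field_cases)
    case (1 k) then show ?thesis using that assms le_t_iff[of i k] by auto
  next
    case (2 k) then show ?thesis using that[of a] assms swap.b_le_t_iff[of k i] top by auto
  qed
qed

end

section \<open>Interval summands of modules over two chains\<close>

locale two_chains_module = two_chains r t b a d + pmodule r M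
  for r :: "('p \<times> 'p) set" and t b a d
    and M :: "('p, 'k::field, 'v::ab_group_add) persistence"
begin

lemma kernel_subspace:
  assumes "(p, q) \<in> r" shows "subspace {y \<in> spc M p. trn M p q y = 0}"
proof -
  have "p \<in> Field r" using assms by (auto simp: Field_def)
  then show ?thesis
    using subspace_spc[of p] trn_zero[OF assms] linear_betweenD[OF linear_trn[OF assms]]
    unfolding subspace_def by simp
qed

lemma image_subspace:
  assumes "(p, q) \<in> r" shows "subspace (trn M p q ` spc M p)"
proof -
  have p: "p \<in> Field r" using assms by (auto simp: Field_def)
  note V = subspace_spc[OF p] and lin = linear_betweenD[OF linear_trn[OF assms]]
  show ?thesis
  proof (rule subspaceI)
    show "0 \<in> trn M p q ` spc M p"
      using trn_zero[OF assms] zero_in[OF p] by (metis imageI)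
  next
    fix y z assume "y \<in> trn M p q ` spc M p" "z \<in> trn M p q ` spc M p"
    then obtain y' z' where "y' \<in> spc M p" "z' \<in> spc M p" "y = trn M p q y'" "z = trn M p q z'" by blast
    then show "y + z \<in> trn M p q ` spc M p"
      using lin(2) subspace_add[OF V] by (intro image_eqI[of _ _ "y' + z'"]) auto
  next
    fix c y assume "y \<in> trn M p q ` spc M p"
    then obtain y' where "y' \<in> spc M p" "y = trn M p q y'" by blast
    then show "scl M c y \<in> trn M p q ` spc M p"
      using lin(3) subspace_scale[OF V] by (intro image_eqI[of _ _ "scl M c y'"]) auto
  qed
qed

text \<open>A vector at the least element generates a full interval module if it survives at the greatest
  element. Any functional that detects it there can be pulled back to all other points.\<close>

lemma full_summand:
  assumes v: "v \<in> spc M (t 0)" and nz: "trn M (t 0) (t a) v \<noteq> 0"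
  shows "\<exists>I x f. interval_summand I x f"
proof -
  have "subspace {0}" by (simp add: subspace_def)
  then obtain g where g: "Vector_Spaces.linear (scl M) (*) g" "g (trn M (t 0) (t a) v) = 1"
    using separating_functional[of "{0}" "trn M (t 0) (t a) v"] nz by blast
  have F: "p \<in> Field r" "q \<in> Field r" if "(p, q) \<in> r" for p q
    using that by (auto simp: Field_def)
  have "interval_summand (Field r) (\<lambda>p. trn M (t 0) p v) (\<lambda>p y. g (trn M p (t a) y))"
    unfolding interval_summand_def
  proof (intro conjI allI impI ballI, goal_cases)
    case 1
    show ?case
      by (rule is_intervalI[where e = "t 0"])
        (use in_Field(1)[of 0] bot_least in \<open>auto simp: Field_def\<close>)
  next
    case (2 p) then show ?case using trn_in[OF bot_least v] by blast
  next
    case (3 p) then show ?case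
      using functional_trn[OF top_greatest linear_between_UNIV[OF g(1)]] by blast
  next
    case (4 p) then show ?case
      using trn_trn[OF bot_least top_greatest v] g(2) by simp
  next
    case (5 p q) then show ?case using trn_trn[OF bot_least _ v] F by simp
  next
    case (6 p q y) then show ?case using trn_trn[OF _ top_greatest] F by simp
  qed
  then show ?thesis by blast
qed

text \<open>
  The vector \<open>v\<close> generates an interval module that ends with \<open>t i\<close> and \<open>b j\<close>. A retraction
  amounts to functionals on the spaces at \<open>t i\<close> and \<open>b j\<close> that agree after pullback to \<open>t 0\<close>. A
  functional \<open>g\<close> on the space at \<open>t 0\<close> factors through both spaces if it vanishes on the kernels of
  the maps to \<open>t i\<close> and \<open>b j\<close>. The first kernel is zero, and \<open>v\<close> is not in the second, so \<open>g\<close> can be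
  chosen with \<open>g v = 1\<close>.
\<close>

lemma left_summand:
  assumes ij: "i < a" "j < d" and v: "v \<in> spc M (t 0)"
    and dies: "trn M (t 0) (t (Suc i)) v = 0" "trn M (t 0) (b (Suc j)) v = 0"
    and inj: "\<And>y. y \<in> spc M (t 0) \<Longrightarrow> trn M (t 0) (t i) y = 0 \<Longrightarrow> y = 0"
    and nz: "trn M (t 0) (b j) v \<noteq> 0"
  shows "\<exists>I x f. interval_summand I x f"
proof -
  define I where "I = {p. (p, t i) \<in> r \<or> (p, b j) \<in> r}"
  have F: "p \<in> Field r" "q \<in> Field r" if "(p, q) \<in> r" for p q
    using that by (auto simp: Field_def)
  have F0: "t 0 \<in> Field r" using in_Field(1)[of 0] by simp
  have ti: "(t 0, t i) \<in> r" and bj: "(t 0, b j) \<in> r"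
    using ij bot_least in_Field by simp_all
  let ?U = "{y \<in> spc M (t 0). trn M (t 0) (b j) y = 0}"
  obtain g where g: "Vector_Spaces.linear (scl M) (*) g" "\<And>y. y \<in> ?U \<Longrightarrow> g y = 0" "g v = 1"
    using separating_functional[OF kernel_subspace[OF bj], of v] nz by blast
  note g_lin = linear_between_UNIV[OF g(1)]
  obtain g1 where g1: "Vector_Spaces.linear (scl M) (*) g1"
    "\<And>y. y \<in> spc M (t 0) \<Longrightarrow> g1 (trn M (t 0) (t i) y) = g y"
    using functional_factors[OF linear_trn[OF ti] subspace_spc[OF F0] g_lin] inj g(2)
      trn_zero[OF bj] by (metis (mono_tags, lifting) mem_Collect_eq)
  obtain g2 where g2: "Vector_Spaces.linear (scl M) (*) g2"
    "\<And>y. y \<in> spc M (t 0) \<Longrightarrow> g2 (trn M (t 0) (b j) y) = g y"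
    using functional_factors[OF linear_trn[OF bj] subspace_spc[OF F0] g_lin] g(2)
    by (metis (mono_tags, lifting) mem_Collect_eq)
  define f where "f p y = (if (p, t i) \<in> r then g1 (trn M p (t i) y) else g2 (trn M p (b j) y))" for p y
  have f1: "f p y = g1 (trn M p (t i) y)" if "(p, t i) \<in> r" for p y
    using that by (simp add: f_def)
  have f2: "f p y = g2 (trn M p (b j) y)" if "(p, b j) \<in> r" "y \<in> spc M p" for p y
    using that below_both[OF ij, of p] g1(2) g2(2) by (auto simp: f_def)
  have dead: "trn M (t 0) q v = 0" if "q \<in> Field r" "q \<notin> I" for q
    using not_below_left[OF ij that(1)] that(2) trn_trn[OF bot_least _ v, of _ q] dies
      trn_zero[of _ q] F unfolding I_def by (metis (mono_tags, lifting) mem_Collect_eq)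
  have I0: "t 0 \<in> I" using ti by (simp add: I_def)
  have IF: "p \<in> Field r" if "p \<in> I" for p using that F unfolding I_def by blast
  have down: "p \<in> I" if "(p, q) \<in> r" "q \<in> I" for p q
    using that trans unfolding I_def by blast
  have "interval_summand I (\<lambda>p. trn M (t 0) p v) f"
    unfolding interval_summand_def
  proof (intro conjI allI impI ballI, goal_cases)
    case 1
    show ?case
      by (rule is_intervalI[OF _ I0]) (use IF bot_least down in blast)+
  next
    case (2 p) then show ?case using trn_in[OF bot_least v] IF by blast
  next
    case (3 p)
    show ?case
    proof (cases "(p, t i) \<in> r")
      case True
      then have "f p = (\<lambda>y. g1 (trn M p (t i) y))" using f1 by auto
      then show ?thesis using functional_trn[OF True linear_between_UNIV[OF g1(1)]] by simp
    next
      case False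
      then have "(p, b j) \<in> r" "f p = (\<lambda>y. g2 (trn M p (b j) y))"
        using 3 by (auto simp: f_def I_def)
      then show ?thesis using functional_trn[OF _ linear_between_UNIV[OF g2(1)]] by simp
    qed
  next
    case (4 p)
    then consider "(p, t i) \<in> r" | "(p, b j) \<in> r" unfolding I_def by blast
    then show ?case
    proof cases
      case 1
      then show ?thesis using f1 trn_trn[OF bot_least _ v] F g1(2)[OF v] g(3) by simp
    next
      case 2
      then show ?thesis using f2 trn_in[OF bot_least v] trn_trn[OF bot_least _ v] F g2(2)[OF v] g(3) by simp
    qed
  next
    case (5 p q) then show ?case using trn_trn[OF bot_least _ v] F dead by simp
  next
    case (6 p q y)
    then consider "(q, t i) \<in> r" | "(q, b j) \<in> r" unfolding I_def by blast
    then have "f q (trn M p q y) = f p y"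
    proof cases
      case 1
      then show ?thesis using f1 trans[OF 6(1)] trn_trn[OF 6(1) _ 6(3)] by simp
    next
      case 2
      then show ?thesis using f2 trans[OF 6(1)] trn_in[OF 6(1,3)] trn_trn[OF 6(1) _ 6(3)] 6(3) by simp
    qed
    then show ?case using down 6 by simp
  qed
  then show ?thesis by blast
qed

text \<open>
  Dually, the vector \<open>w\<close> at the greatest element is hit from \<open>t (i + 1)\<close> and \<open>b (j + 1)\<close>, and
  lifts \<open>u1\<close>, \<open>u2\<close> of it generate an interval module. A retraction is the pullback of a functional
  at the greatest element; it must vanish on what comes from \<open>t i\<close>, which is zero, and on what
  comes from \<open>b j\<close>, which does not contain \<open>w\<close>.
\<close>

lemma right_summand:
  assumes ij: "i < a" "j < d"
    and u: "u1 \<in> spc M (t (Suc i))" "u2 \<in> spc M (b (Suc j))"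
      "trn M (t (Suc i)) (t a) u1 = w" "trn M (b (Suc j)) (t a) u2 = w"
    and zero: "\<And>y. y \<in> spc M (t i) \<Longrightarrow> trn M (t i) (t a) y = 0"
    and unborn: "w \<notin> trn M (b j) (t a) ` spc M (b j)"
  shows "\<exists>I x f. interval_summand I x f"
proof -
  define I where "I = {p. (t (Suc i), p) \<in> r \<or> (b (Suc j), p) \<in> r}"
  have F: "p \<in> Field r" "q \<in> Field r" if "(p, q) \<in> r" for p q
    using that by (auto simp: Field_def)
  have Fa: "t a \<in> Field r" using in_Field(1)[of a] by simp
  have ti: "(t (Suc i), t a) \<in> r" and bj: "(b (Suc j), t a) \<in> r" "(b j, t a) \<in> r"
    using ij top_greatest in_Field by simp_all
  obtain g where g: "Vector_Spaces.linear (scl M) (*) g"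
    "\<And>y. y \<in> trn M (b j) (t a) ` spc M (b j) \<Longrightarrow> g y = 0" "g w = 1"
    using separating_functional[OF image_subspace[OF bj(2)] unborn] by blast
  define x where "x p = (if (t (Suc i), p) \<in> r then trn M (t (Suc i)) p u1 else trn M (b (Suc j)) p u2)" for p
  have x1: "x p = trn M (t (Suc i)) p u1" if "(t (Suc i), p) \<in> r" for p
    using that by (simp add: x_def)
  have x2: "x p = trn M (b (Suc j)) p u2" if "(b (Suc j), p) \<in> r" for p
    using that above_both[OF ij, of p] u(3,4) by (auto simp: x_def)
  have dead: "g (trn M q (t a) y) = 0" if q: "q \<in> Field r" "q \<notin> I" and y: "y \<in> spc M q" for q y
  proof -
    have g0: "g 0 = 0"
      using g(2)[OF subspace_0[OF image_subspace[OF bj(2)]]] .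
    consider "(q, t i) \<in> r" | "(q, b j) \<in> r"
      using not_above_right[OF ij q(1)] q(2) unfolding I_def by blast
    then show ?thesis
    proof cases
      case 1
      then have "trn M q (t a) y = trn M (t i) (t a) (trn M q (t i) y)"
        using trn_trn[OF 1 top_greatest y] F by simp
      then show ?thesis using zero trn_in[OF 1 y] g0 by simp
    next
      case 2
      then have "trn M q (t a) y = trn M (b j) (t a) (trn M q (b j) y)"
        using trn_trn[OF 2 top_greatest y] F by simp
      then show ?thesis using g(2) trn_in[OF 2 y] by simp
    qed
  qed
  have Ia: "t a \<in> I" using ti by (simp add: I_def)
  have IF: "p \<in> Field r" if "p \<in> I" for p using that F unfolding I_def by blast
  have up: "q \<in> I" if "(p, q) \<in> r" "p \<in> I" for p q
    using that trans unfolding I_def by blast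
  have "interval_summand I x (\<lambda>p y. g (trn M p (t a) y))"
    unfolding interval_summand_def
  proof (intro conjI allI impI ballI, goal_cases)
    case 1
    show ?case
      by (rule is_intervalI[OF _ Ia]) (use IF top_greatest up in blast)+
  next
    case (2 p)
    then show ?case using x1 x2 trn_in u(1,2) unfolding I_def by auto
  next
    case (3 p) then show ?case
      using functional_trn[OF top_greatest linear_between_UNIV[OF g(1)]] IF by blast
  next
    case (4 p)
    then consider "(t (Suc i), p) \<in> r" | "(b (Suc j), p) \<in> r" unfolding I_def by blast
    then show ?case
    proof cases
      case 1
      then show ?thesis using x1 trn_trn[OF 1 top_greatest u(1)] F u(3) g(3) by simp
    next
      case 2
      then show ?thesis using x2 trn_trn[OF 2 top_greatest u(2)] F u(4) g(3) by simp
    qed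
  next
    case (5 p q)
    then consider "(t (Suc i), p) \<in> r" | "(b (Suc j), p) \<in> r" unfolding I_def by blast
    then have "trn M p q (x p) = x q"
    proof cases
      case 1
      then show ?thesis using x1 trans[OF 1 5(1)] trn_trn[OF 1 5(1) u(1)] by simp
    next
      case 2
      then show ?thesis using x2 trans[OF 2 5(1)] trn_trn[OF 2 5(1) u(2)] by simp
    qed
    then show ?case using up 5 by simp
  next
    case (6 p q y)
    then show ?case using trn_trn[OF 6(1) top_greatest 6(3)] dead F by simp
  qed
  then show ?thesis by blast
qed

text \<open>Inside one chain, with nothing coming from below: a vector at \<open>t (i + 1)\<close> that dies exactly
  after \<open>t j\<close> generates an interval module, and a functional at \<open>t j\<close> that detects it retracts
  onto that module.\<close>

lemma chain_summand:
  assumes ij: "Suc i \<le> j" "j < a" and v: "v \<in> spc M (t (Suc i))"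
    and unborn: "spc M (t i) = {0}"
    and dies: "trn M (t (Suc i)) (t (Suc j)) v = 0"
    and nz: "trn M (t (Suc i)) (t j) v \<noteq> 0"
  shows "\<exists>I x f. interval_summand I x f"
proof -
  define I where "I = {p. (t (Suc i), p) \<in> r \<and> (p, t j) \<in> r}"
  have F: "p \<in> Field r" "q \<in> Field r" if "(p, q) \<in> r" for p q
    using that by (auto simp: Field_def)
  have le: "(t (Suc i), t j) \<in> r" using ij le_t by simp
  have "subspace {0}" by (simp add: subspace_def)
  then obtain g where g: "Vector_Spaces.linear (scl M) (*) g" "g (trn M (t (Suc i)) (t j) v) = 1"
    using separating_functional[of "{0}" "trn M (t (Suc i)) (t j) v"] nz by blast
  have g0: "g 0 = 0"
    using linear_between_zero[OF linear_between_UNIV[OF g(1)] subspace_UNIV] .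
  have early: "g (trn M p (t j) y) = 0"
    if pq: "(p, q) \<in> r" "q \<in> I" "p \<notin> I" and y: "y \<in> spc M p" for p q y
  proof -
    have pj: "(p, t j) \<in> r" using pq trans unfolding I_def by blast
    then obtain k where k: "k \<le> j" "p = t k" using below_t ij(2) by blast
    then have "k \<le> i" using pq(3) pj ij le_t[of "Suc i" k] unfolding I_def by fastforce
    then have pi: "(p, t i) \<in> r" using k ij le_t by simp
    moreover have "(t i, t j) \<in> r" using ij le_t by simp
    ultimately have "trn M p (t j) y = trn M (t i) (t j) (trn M p (t i) y)"
      using trn_trn y by simp
    also have "trn M p (t i) y = 0" using trn_in[OF pi y] unborn by simp
    finally show ?thesis using trn_zero[OF \<open>(t i, t j) \<in> r\<close>] g0 by simp
  qed
  have late: "trn M (t (Suc i)) q v = 0" if pq: "(p, q) \<in> r" "p \<in> I" "q \<notin> I" for p q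
  proof -
    have iq: "(t (Suc i), q) \<in> r" using pq trans unfolding I_def by blast
    then obtain k where k: "k \<le> a" "q = t k" using above_t ij by (metis Suc_leI le_trans less_imp_le zero_less_Suc)
    then have "Suc j \<le> k" using pq(3) iq ij le_t[of k j] unfolding I_def by fastforce
    then have jq: "(t (Suc j), q) \<in> r" using k le_t by simp
    have "(t (Suc i), t (Suc j)) \<in> r" using ij le_t by simp
    then have "trn M (t (Suc i)) q v = trn M (t (Suc j)) q (trn M (t (Suc i)) (t (Suc j)) v)"
      using trn_trn jq v by simp
    then show ?thesis using dies trn_zero[OF jq] by simp
  qed
  have "interval_summand I (\<lambda>p. trn M (t (Suc i)) p v) (\<lambda>p y. g (trn M p (t j) y))"
    unfolding interval_summand_def
  proof (intro conjI allI impI ballI, goal_cases)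
    case 1
    show ?case
    proof (rule is_intervalI[where e = "t j"])
      show "t j \<in> I" using ij le le_t[of j j] unfolding I_def by simp
    next
      show "I \<subseteq> Field r" using F unfolding I_def by blast
      show "(p, t j) \<in> r \<or> (t j, p) \<in> r" if "p \<in> I" for p using that unfolding I_def by blast
      show "q \<in> I" if "p \<in> I" "s \<in> I" "(p, q) \<in> r" "(q, s) \<in> r" for p q s
        using that trans unfolding I_def by blast
    qed
  next
    case (2 p) then show ?case using trn_in[OF _ v] unfolding I_def by blast
  next
    case (3 p) then show ?case
      using functional_trn[OF _ linear_between_UNIV[OF g(1)]] unfolding I_def by blast
  next
    case (4 p) then show ?case
      using trn_trn[OF _ _ v, of p "t j"] g(2) unfolding I_def by simp
  next
    case (5 p q) then show ?case
      using trn_trn[OF _ 5(1) v] late[OF 5(1)] unfolding I_def by simp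
  next
    case (6 p q y)
    then have "trn M q (t j) (trn M p q y) = trn M p (t j) y"
      using trn_trn[OF 6(1) _ 6(3)] unfolding I_def by simp
    then show ?case using early[OF 6(1,2) _ 6(3)] by simp
  qed
  then show ?thesis by blast
qed

text \<open>The interval starts at the first nonzero space and ends before the first point of the chain
  at which some nonzero vector of that space dies. The choice of the first such point makes the vector
  survive at the point before.\<close>

lemma interior_summand:
  assumes ends: "spc M (t 0) = {0}" "spc M (t a) = {0}" and k: "k \<le> a" "spc M (t k) \<noteq> {0}"
  shows "\<exists>I x f. interval_summand I x f"
proof -
  obtain i where i: "i < k" "spc M (t i) = {0}" "spc M (t (Suc i)) \<noteq> {0}"
    using ex_least_nat_less[of "\<lambda>k. spc M (t k) \<noteq> {0}" k] k(2) ends(1) by blast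
  let ?P = "\<lambda>j. Suc i \<le> j \<and> (\<exists>v\<in>spc M (t (Suc i)). v \<noteq> 0 \<and> trn M (t (Suc i)) (t j) v = 0)"
  have F: "t (Suc i) \<in> Field r" using i k in_Field by simp
  obtain v where v: "v \<in> spc M (t (Suc i))" "v \<noteq> 0"
    using i(3) zero_in[OF F] by blast
  have "trn M (t (Suc i)) (t a) v = 0"
    using trn_in[OF top_greatest[OF F] v(1)] ends(2) by simp
  then have "?P a" using v i k by auto
  then obtain j where j: "j < a" "\<forall>l\<le>j. \<not> ?P l" "?P (Suc j)"
    using ex_least_nat_less[of ?P a] by blast
  obtain v where v: "v \<in> spc M (t (Suc i))" "v \<noteq> 0" "trn M (t (Suc i)) (t (Suc j)) v = 0"
    using j(3) by blast
  have "Suc i \<noteq> Suc j" using v trn_id[OF F v(1)] by auto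
  then have "Suc i \<le> j" using j(3) by simp
  then have "trn M (t (Suc i)) (t j) v \<noteq> 0" using j(2) v by blast
  then show ?thesis using chain_summand \<open>Suc i \<le> j\<close> j(1) v i(2) by blast
qed

text \<open>
  In the second and third case the index on the first chain is the least one for which the kernel
  (or the image) is nonzero, and the index on the second chain is the least one for which the
  kernel (or image) still meets it outside zero. Minimality yields the hypotheses of
  \<open>left_summand\<close> and \<open>right_summand\<close> about the preceding indices.
\<close>

theorem interval_summand_exists:
  assumes nonzero: "\<exists>p\<in>Field r. spc M p \<noteq> {0}"
  shows "\<exists>I x f. interval_summand I x f"
proof -
  have F0: "t 0 \<in> Field r" and Fa: "t a \<in> Field r" using in_Field by simp_all
  have Fb: "b j \<in> Field r" if "j \<le> d" for j using in_Field that by simp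
  consider (full) "\<exists>v\<in>spc M (t 0). trn M (t 0) (t a) v \<noteq> 0"
    | (left) "\<forall>v\<in>spc M (t 0). trn M (t 0) (t a) v = 0" "spc M (t 0) \<noteq> {0}"
    | (right) "\<forall>v\<in>spc M (t 0). trn M (t 0) (t a) v = 0" "spc M (t a) \<noteq> {0}"
    | (interior) "spc M (t 0) = {0}" "spc M (t a) = {0}" by blast
  then show ?thesis
  proof cases
    case full
    then show ?thesis using full_summand by blast
  next
    case left
    obtain v where v: "v \<in> spc M (t 0)" "v \<noteq> 0" using left(2) zero_in[OF F0] by blast
    let ?P = "\<lambda>i. \<exists>v\<in>spc M (t 0). v \<noteq> 0 \<and> trn M (t 0) (t i) v = 0"
    have "?P a" "\<not> ?P 0" using v left(1) trn_id[OF F0] by auto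
    then obtain i where i: "i < a" "\<forall>l\<le>i. \<not> ?P l" "?P (Suc i)"
      using ex_least_nat_less[of ?P a] by blast
    let ?Q = "\<lambda>j. \<exists>v\<in>spc M (t 0). v \<noteq> 0 \<and> trn M (t 0) (t (Suc i)) v = 0 \<and> trn M (t 0) (b j) v = 0"
    have "?Q d" "\<not> ?Q 0" using i(3) left(1) trn_id[OF F0] top bot by auto
    then obtain j where j: "j < d" "\<forall>l\<le>j. \<not> ?Q l" "?Q (Suc j)"
      using ex_least_nat_less[of ?Q d] by blast
    then obtain v where v: "v \<in> spc M (t 0)" "v \<noteq> 0" "trn M (t 0) (t (Suc i)) v = 0"
      "trn M (t 0) (b (Suc j)) v = 0" by blast
    show ?thesis
      by (rule left_summand[OF i(1) j(1) v(1,3,4)]) (use i(2) j(2) v in blast)+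
  next
    case right
    obtain w where w: "w \<in> spc M (t a)" "w \<noteq> 0" using right(2) zero_in[OF Fa] by blast
    let ?P = "\<lambda>i. \<exists>u\<in>spc M (t i). trn M (t i) (t a) u \<noteq> 0"
    have "?P a" "\<not> ?P 0" using w right(1) trn_id[OF Fa] by auto
    then obtain i where i: "i < a" "\<forall>l\<le>i. \<not> ?P l" "?P (Suc i)"
      using ex_least_nat_less[of ?P a] by blast
    let ?Q = "\<lambda>j. \<exists>u1\<in>spc M (t (Suc i)). \<exists>u2\<in>spc M (b j).
      trn M (t (Suc i)) (t a) u1 \<noteq> 0 \<and> trn M (b j) (t a) u2 = trn M (t (Suc i)) (t a) u1"
    have Fi: "t (Suc i) \<in> Field r" using i(1) in_Field by simp
    have "?Q d" using i(3) trn_id[OF Fa] trn_in[OF top_greatest[OF Fi]] top by metis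
    moreover have "\<not> ?Q 0" using right(1) bot by auto
    ultimately obtain j where j: "j < d" "\<forall>l\<le>j. \<not> ?Q l" "?Q (Suc j)"
      using ex_least_nat_less[of ?Q d] by blast
    then obtain u1 u2 where u: "u1 \<in> spc M (t (Suc i))" "u2 \<in> spc M (b (Suc j))"
      "trn M (t (Suc i)) (t a) u1 \<noteq> 0"
      "trn M (b (Suc j)) (t a) u2 = trn M (t (Suc i)) (t a) u1" by blast
    show ?thesis
    proof (rule right_summand[OF i(1) j(1) u(1,2) refl u(4)])
      show "trn M (t i) (t a) y = 0" if "y \<in> spc M (t i)" for y
        using i(2) that by blast
      show "trn M (t (Suc i)) (t a) u1 \<notin> trn M (b j) (t a) ` spc M (b j)"
      proof
        assume "trn M (t (Suc i)) (t a) u1 \<in> trn M (b j) (t a) ` spc M (b j)"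
        then obtain u2' where "u2' \<in> spc M (b j)" "trn M (b j) (t a) u2' = trn M (t (Suc i)) (t a) u1"
          by (metis imageE)
        then show False using j(2) u(1,3) by blast
      qed
    qed
  next
    case interior
    obtain p where p: "p \<in> Field r" "spc M p \<noteq> {0}" using nonzero by blast
    interpret swap: two_chains_module r b t d a M by unfold_locales
    show ?thesis
      using p(1)
    proof (cases rule: Field_cases)
      case (1 k)
      then show ?thesis using interior_summand[OF interior, of k] p(2) by simp
    next
      case (2 k)
      then show ?thesis using swap.interior_summand[of k] interior bot top p(2) by simp
    qed
  qed
qed

end

section \<open>Pullback of interval bases\<close>

text \<open>Components of the comparability graph of a subset. In this form, membership of a given set is
  checked by connectedness and by looking at its neighbours only.\<close>

definition components :: "('p \<times> 'p) set \<Rightarrow> 'p set \<Rightarrow> 'p set set" where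
  "components r P =
     {C. C \<noteq> {} \<and> C \<subseteq> P \<and>
         (\<forall>x\<in>C. \<forall>y\<in>C. (x, y) \<in> (Restr (r \<union> r\<inverse>) C)\<^sup>*) \<and>
         (\<forall>x\<in>C. \<forall>y\<in>P. (x, y) \<in> r \<union> r\<inverse> \<longrightarrow> y \<in> C)}"

lemma componentsI:
  assumes "C \<noteq> {}" "C \<subseteq> P"
    and "\<And>x y. x \<in> C \<Longrightarrow> y \<in> C \<Longrightarrow> (x, y) \<in> (Restr (r \<union> r\<inverse>) C)\<^sup>*"
    and "\<And>x y. x \<in> C \<Longrightarrow> y \<in> P \<Longrightarrow> (x, y) \<in> r \<union> r\<inverse> \<Longrightarrow> y \<in> C"
  shows "C \<in> components r P"
  unfolding components_def
  by (rule CollectI, intro conjI ballI impI) (fact assms(1), fact assms(2), rule assms(3), assumption+,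
      rule assms(4), assumption+)

lemma componentsD:
  assumes "C \<in> components r P"
  shows "C \<noteq> {}" "C \<subseteq> P" "\<forall>x\<in>C. \<forall>y\<in>C. (x, y) \<in> (Restr (r \<union> r\<inverse>) C)\<^sup>*"
    "\<forall>x\<in>C. \<forall>y\<in>P. (x, y) \<in> r \<union> r\<inverse> \<longrightarrow> y \<in> C"
proof -
  note C = assms[unfolded components_def mem_Collect_eq]
  show "C \<noteq> {}" by (rule C[THEN conjunct1])
  show "C \<subseteq> P" by (rule C[THEN conjunct2, THEN conjunct1])
  show "\<forall>x\<in>C. \<forall>y\<in>C. (x, y) \<in> (Restr (r \<union> r\<inverse>) C)\<^sup>*"
    by (rule C[THEN conjunct2, THEN conjunct2, THEN conjunct1])
  show "\<forall>x\<in>C. \<forall>y\<in>P. (x, y) \<in> r \<union> r\<inverse> \<longrightarrow> y \<in> C"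
    by (rule C[THEN conjunct2, THEN conjunct2, THEN conjunct2])
qed

lemma component_exists:
  assumes "p \<in> P"
  shows "\<exists>C\<in>components r P. p \<in> C"
proof -
  let ?R = "Restr (r \<union> r\<inverse>) P"
  let ?C = "{y. (p, y) \<in> ?R\<^sup>*}"
  have sub: "?C \<subseteq> P"
  proof clarify
    fix y assume "(p, y) \<in> ?R\<^sup>*"
    then show "y \<in> P" by induction (use assms in auto)
  qed
  have from_p: "(p, y) \<in> (Restr (r \<union> r\<inverse>) ?C)\<^sup>*" if "(p, y) \<in> ?R\<^sup>*" for y
    using that
  proof induction
    case (step y z)
    then have "(y, z) \<in> Restr (r \<union> r\<inverse>) ?C" by (auto intro: rtrancl_into_rtrancl)
    then show ?case using step.IH by (rule rtrancl_into_rtrancl[rotated])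
  qed simp
  have sym: "sym ((Restr (r \<union> r\<inverse>) ?C)\<^sup>*)"
    by (intro sym_rtrancl) (auto simp: sym_def)
  have connected: "(x, y) \<in> (Restr (r \<union> r\<inverse>) ?C)\<^sup>*" if "x \<in> ?C" "y \<in> ?C" for x y
  proof (rule rtrancl_trans)
    show "(x, p) \<in> (Restr (r \<union> r\<inverse>) ?C)\<^sup>*" using symD[OF sym from_p] that(1) by simp
    show "(p, y) \<in> (Restr (r \<union> r\<inverse>) ?C)\<^sup>*" using from_p that(2) by simp
  qed
  have closed: "y \<in> ?C" if "x \<in> ?C" "y \<in> P" "(x, y) \<in> r \<union> r\<inverse>" for x y
  proof -
    have "(x, y) \<in> ?R" using that sub by auto
    then show ?thesis using that(1) by (auto intro: rtrancl_into_rtrancl)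
  qed
  have "p \<in> ?C" by simp
  moreover have "?C \<in> components r P"
    by (rule componentsI[OF _ sub connected closed]) (use \<open>p \<in> ?C\<close> in blast)
  ultimately show ?thesis by (rule bexI)
qed

lemma component_subset:
  assumes "C \<in> components r P" "C' \<in> components r P" "p \<in> C" "p \<in> C'"
  shows "C \<subseteq> C'"
proof
  fix y assume "y \<in> C"
  then have "(p, y) \<in> (Restr (r \<union> r\<inverse>) C)\<^sup>*"
    using componentsD(3)[OF assms(1)] assms(3) by blast
  then show "y \<in> C'"
  proof induction
    case (step y z)
    then have "z \<in> P" "(y, z) \<in> r \<union> r\<inverse>"
      using componentsD(2)[OF assms(1)] by auto
    then show ?case using componentsD(4)[OF assms(2)] step.IH by blast
  qed (fact assms(4))
qed

lemma component_unique:
  "C \<in> components r P \<Longrightarrow> C' \<in> components r P \<Longrightarrow> p \<in> C \<Longrightarrow> p \<in> C' \<Longrightarrow> C = C'"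
  using component_subset by (metis subset_antisym)

lemma is_interval_convex:
  assumes I: "is_interval r I" and "x \<in> I" "z \<in> I" "(x, y) \<in> r" "(y, z) \<in> r"
  shows "y \<in> I"
proof -
  have "\<forall>x\<in>I. \<forall>z\<in>I. \<forall>y. (x, y) \<in> r \<longrightarrow> (y, z) \<in> r \<longrightarrow> y \<in> I"
    using I unfolding is_interval_def by (elim conjE)
  then show ?thesis using assms(2-) by blast
qed

lemma component_interval:
  assumes mono: "\<And>p q. (p, q) \<in> r' \<Longrightarrow> (f p, f q) \<in> r" and I: "is_interval r I"
    and C: "C \<in> components r' {p \<in> Field r'. f p \<in> I}"
  shows "is_interval r' C"
proof -
  have "\<forall>x\<in>C. \<forall>z\<in>C. \<forall>y. (x, y) \<in> r' \<longrightarrow> (y, z) \<in> r' \<longrightarrow> y \<in> C"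
  proof (intro ballI allI impI)
    fix x z y assume that: "x \<in> C" "z \<in> C" "(x, y) \<in> r'" "(y, z) \<in> r'"
    have "f x \<in> I" "f z \<in> I" using that componentsD(2)[OF C] by auto
    then have "f y \<in> I" using is_interval_convex[OF I] mono that(3,4) by blast
    moreover have "y \<in> Field r'" using that(3) by (auto simp: Field_def)
    ultimately show "y \<in> C" using componentsD(4)[OF C] that(1,3) by blast
  qed
  moreover have "C \<subseteq> Field r'"
    using componentsD(2)[OF C] by auto
  ultimately show ?thesis
    unfolding is_interval_def using componentsD(1,3)[OF C] by (intro conjI)
qed

lemma pullback_simps [simp]:
  "scl (pullback f M) = scl M" "spc (pullback f M) p = spc M (f p)"
  "trn (pullback f M) p q = trn M (f p) (f q)"
  by (simp_all add: pullback_def)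

lemma monotone_Field:
  assumes "\<And>p q. (p, q) \<in> r' \<Longrightarrow> (f p, f q) \<in> r" "p \<in> Field r'"
  shows "f p \<in> Field r"
  using assms unfolding Field_def by blast

lemma persistence_module_pullback:
  assumes mono: "\<And>p q. (p, q) \<in> r' \<Longrightarrow> (f p, f q) \<in> r" and "persistence_module r M"
  shows "persistence_module r' (pullback f M)"
proof -
  interpret pmodule r M by unfold_locales fact
  show ?thesis
    unfolding persistence_module_def
    using vector_space_axioms subspace_spc finitely_spanned linear_trn trn_id trn_trn mono
      monotone_Field[of r' f r, OF mono] by fastforce
qed

text \<open>The interval module of \<open>I\<close> pulls back to the direct sum of the interval modules of the
  components of the preimage of \<open>I\<close>, as every point of the preimage lies in exactly one
  component.\<close>

lemma interval_basis_pullback: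
  fixes M :: "('p, 'k::field, 'v::ab_group_add) persistence" and f :: "'q \<Rightarrow> 'p"
  assumes fin: "finite (Field r')" and mono: "\<And>p q. (p, q) \<in> r' \<Longrightarrow> (f p, f q) \<in> r"
    and M: "persistence_module r M" "interval_basis r M S J x l"
  shows "interval_basis r' (pullback f M) (SIGMA s:S. components r' {p \<in> Field r'. f p \<in> J s}) snd
    (\<lambda>(s, C) p. if p \<in> C then x s (f p) else 0) (\<lambda>(s, C) p y. if p \<in> C then l s (f p) y else 0)"
proof -
  interpret interval_based r M S J x l using M by unfold_locales
  let ?P = "\<lambda>s. {p \<in> Field r'. f p \<in> J s}"
  have sub: "C \<subseteq> ?P s" if "C \<in> components r' (?P s)" for s C
    by (rule componentsD(2)[OF that])
  have fin_components: "finite (components r' (?P s))" for s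
    by (rule finite_subset[of _ "Pow (Field r')"]) (use fin sub in auto)
  have Ff: "f p \<in> Field r" if "p \<in> Field r'" for p
    using monotone_Field[of r' f r, OF mono that] .
  have closed: "q \<in> C \<longleftrightarrow> f q \<in> J s" if "C \<in> components r' (?P s)" "p \<in> C" "(p, q) \<in> r'" for s C p q
  proof -
    have "q \<in> Field r'" using that(3) by (auto simp: Field_def)
    then show ?thesis using that sub[OF that(1)] componentsD(4)[OF that(1)] by blast
  qed
  show ?thesis
    unfolding interval_basis_def
  proof (intro conjI ballI allI impI, goal_cases)
    case 1 show ?case using finite_index fin_components by blast
  next
    case (2 u)
    then obtain s C where "u = (s, C)" "s \<in> S" "C \<in> components r' (?P s)" by blast
    then show ?case
      using component_interval[of r' f r "J s" C, OF mono interval] by simp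
  next
    case (3 u p) then show ?case using vec_in Ff sub by fastforce
  next
    case (4 u p) then show ?case by (auto split: prod.splits)
  next
    case (5 u pq)
    obtain s C where u: "u = (s, C)" "s \<in> S" "C \<in> components r' (?P s)" using 5(1) by blast
    obtain p q where pq: "pq = (p, q)" by force
    have "trn M (f p) (f q) (x s (f p)) = (if q \<in> C then x s (f q) else 0)" if "p \<in> C" "(p, q) \<in> r'"
      using trn_vec[OF u(2) mono[OF that(2)]] vec_zero[OF u(2)] closed[OF u(3) that] sub[OF u(3)] that(1)
      by auto
    then show ?case using 5(2) u pq by auto
  next
    case (6 u p)
    obtain s C where u: "u = (s, C)" "s \<in> S" using 6(1) by blast
    show ?case
      using functional[OF u(2) Ff[OF 6(2)]] by (auto simp: u linear_between_def)
  next
    case (7 u w p)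
    obtain s C s' C' where u: "u = (s, C)" "s \<in> S" "C \<in> components r' (?P s)"
      and w: "w = (s', C')" "s' \<in> S" "C' \<in> components r' (?P s')" using 7(1,2) by blast
    have "l s (f p) 0 = 0"
      using linear_between_zero[OF functional subspace_spc] u(2) Ff[OF 7(3)] by blast
    moreover have "f p \<in> J s'" if "p \<in> C'" using sub[OF w(3)] that by blast
    moreover have "C = C'" if "s = s'" "p \<in> C" "p \<in> C'" using component_unique that u(3) w(3) by metis
    ultimately show ?case
      using dual[OF u(2) w(2) Ff[OF 7(3)]] by (auto simp: u w)
  next
    case (8 p y)
    have y: "y \<in> spc M (f p)" using 8(2) by simp
    have "(\<Sum>u\<in>(SIGMA s:S. components r' (?P s)).
        scl (pullback f M) ((case u of (s, C) \<Rightarrow> \<lambda>p y. if p \<in> C then l s (f p) y else 0) p y)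
          ((case u of (s, C) \<Rightarrow> \<lambda>p. if p \<in> C then x s (f p) else 0) p)) =
      (\<Sum>s\<in>S. \<Sum>C\<in>components r' (?P s). if p \<in> C then scl M (l s (f p) y) (x s (f p)) else 0)"
      using finite_index fin_components
      by (subst sum.Sigma) (auto intro!: sum.cong)
    also have "\<dots> = (\<Sum>s\<in>S. scl M (l s (f p) y) (x s (f p)))"
    proof (intro sum.cong refl)
      fix s assume s: "s \<in> S"
      let ?v = "scl M (l s (f p) y) (x s (f p))"
      show "(\<Sum>C\<in>components r' (?P s). if p \<in> C then ?v else 0) = ?v"
      proof (cases "f p \<in> J s")
        case True
        then obtain C where C: "C \<in> components r' (?P s)" "p \<in> C"
          using component_exists[of p "?P s" r'] 8(1) by blast
        have "p \<in> C' \<longleftrightarrow> C' = C" if "C' \<in> components r' (?P s)" for C'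
          using component_unique[OF that C(1) _ C(2)] C(2) by blast
        then have "(\<Sum>C'\<in>components r' (?P s). if p \<in> C' then ?v else 0) =
            (\<Sum>C'\<in>components r' (?P s). if C' = C then ?v else 0)"
          by (intro sum.cong refl if_cong)
        then show ?thesis using C(1) fin_components by simp
      next
        case False
        then show ?thesis using vec_zero[OF s] by (simp cong: if_cong)
      qed
    qed
    also have "\<dots> = y" by (rule expansion[OF Ff[OF 8(1)] y])
    finally show ?case by simp
  qed
qed

text \<open>The summands of type \<open>K\<close> in the pullback are the summands of \<open>M\<close> for whose interval \<open>K\<close> is a
  component of the preimage. By the last hypothesis these are the summands of type \<open>I\<close>.\<close>

theorem interval_mult_pullback:
  fixes M :: "('p, 'k::field, 'v::ab_group_add) persistence" and f :: "'q \<Rightarrow> 'p"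
  assumes fin: "finite (Field r')" and mono: "\<And>p q. (p, q) \<in> r' \<Longrightarrow> (f p, f q) \<in> r"
    and M: "persistence_module r M" "interval_basis r M S J x l"
    and K: "\<And>I'. is_interval r I' \<Longrightarrow>
      K \<in> components r' {p \<in> Field r'. f p \<in> I'} \<longleftrightarrow> I' = I"
  shows "interval_mult r M I = interval_mult r' (pullback f M) K"
proof -
  let ?U = "SIGMA s:S. components r' {p \<in> Field r'. f p \<in> J s}"
  have "is_interval r (J s)" if "s \<in> S" for s
    using M(2) that unfolding interval_basis_def by blast
  then have "{u \<in> ?U. snd u = K} = (\<lambda>s. (s, K)) ` {s \<in> S. J s = I}"
    using K by auto
  then have "card {u \<in> ?U. snd u = K} = card {s \<in> S. J s = I}"
    by (simp add: card_image inj_on_def)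
  then show ?thesis
    using interval_mult_interval_basis[OF M]
      interval_mult_interval_basis[OF persistence_module_pullback[of r' f r, OF mono M(1)]
        interval_basis_pullback[OF fin mono M]] by simp
qed

section \<open>The bipath poset as two chains\<close>

lemma bipath_iff:
  "(x, y) \<in> bipath n m \<longleftrightarrow>
     0 \<le> x \<and> x \<le> y \<and> y \<le> n \<or> x = 0 \<and> (y = 0 \<or> n \<le> y \<and> y \<le> n + m - 1) \<or>
     n \<le> y \<and> y \<le> x \<and> x \<le> n + m - 1"
  unfolding bipath_def by auto

text \<open>The function \<open>\<lambda>k. if k = 0 then 0 else n + m - int k\<close> enumerates the second chain from below:
  \<open>0, n + m - 1, \<dots>, n + 1, n\<close>.\<close>

lemma two_chains_bipath:
  fixes n m :: int
  assumes "n > 1" "m > 1"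
  shows "two_chains (bipath n m) int (\<lambda>k. if k = 0 then 0 else n + m - int k) (nat n) (nat m)"
    (is "two_chains _ _ ?b _ _")
proof
  show "bipath n m = {(int i, int j) | i j. i \<le> j \<and> j \<le> nat n} \<union>
      {(?b i, ?b j) | i j. i \<le> j \<and> j \<le> nat m}" (is "_ = ?T \<union> ?B")
  proof (intro equalityI subrelI)
    fix x y assume "(x, y) \<in> bipath n m"
    then consider "0 \<le> x" "x \<le> y" "y \<le> n" | "x = 0" "y = 0"
      | "x = 0" "n \<le> y" "y \<le> n + m - 1" | "n \<le> y" "y \<le> x" "x \<le> n + m - 1"
      unfolding bipath_iff by blast
    then show "(x, y) \<in> ?T \<union> ?B"
    proof cases
      case 1
      then show ?thesis by (intro UnI1 CollectI exI[of _ "nat x"] exI[of _ "nat y"]) auto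
    next
      case 2
      then show ?thesis by (intro UnI1 CollectI exI[of _ 0]) auto
    next
      case 3
      then show ?thesis using assms
        by (intro UnI2 CollectI exI[of _ 0] exI[of _ "nat (n + m - y)"]) auto
    next
      case 4
      then show ?thesis using assms
        by (intro UnI2 CollectI exI[of _ "nat (n + m - x)"] exI[of _ "nat (n + m - y)"]) auto
    qed
  next
    fix x y assume "(x, y) \<in> ?T \<union> ?B"
    then show "(x, y) \<in> bipath n m"
      using assms unfolding bipath_iff by (auto split: if_splits)
  qed
  show "inj_on ?b {..nat m}"
    using assms by (auto simp: inj_on_def split: if_splits)
  show "i = 0 \<and> j = 0 \<or> i = nat n \<and> j = nat m" if "i \<le> nat n" "j \<le> nat m" "int i = ?b j" for i j
    using that assms by (auto split: if_splits)
qed (use assms in auto)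

theorem bipath_interval_basis_exists:
  fixes M :: "(int, 'k::field, 'v::ab_group_add) persistence"
  assumes nm: "n > 1" "m > 1" and "persistence_module (bipath n m) M"
  shows "\<exists>(S :: nat set) J x l. interval_basis (bipath n m) M S J x l"
proof (rule interval_basis_exists[OF _ assms(3)])
  show "finite (Field (bipath n m))"
    using Field_bipath[OF nm] by (simp add: bipath_set_def)
next
  fix N :: "(int, 'k, 'v) persistence"
  assume N: "persistence_module (bipath n m) N" and nonzero: "\<exists>p\<in>Field (bipath n m). spc N p \<noteq> {0}"
  interpret two_chains_module "bipath n m" int "\<lambda>k. if k = 0 then 0 else n + m - int k" "nat n" "nat m" N
    using two_chains_bipath[OF nm] N by (intro two_chains_module.intro pmodule.intro)
  show "\<exists>I x f. interval_summand I x f"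
    by (rule interval_summand_exists[OF nonzero])
qed

section \<open>Positions in the zigzag\<close>

text \<open>The zigzag is a fence, and the sum of its two coordinates numbers its elements from left to
  right: \<open>2 * c\<close> is the position of the maximal element \<open>(c, c)\<close>, and \<open>2 * c + 1\<close> that of the minimal
  element \<open>(c + 1, c)\<close>. All intervals become integer intervals of positions.\<close>

definition zz_at :: "int \<Rightarrow> int \<times> int" where
  "zz_at k = ((k + 1) div 2, k div 2)"

lemma zz_at_even: "zz_at (2 * c) = (c, c)"
  by (simp add: zz_at_def)

lemma zz_at_odd: "zz_at (2 * c + 1) = (c + 1, c)"
  by (simp add: zz_at_def)

lemma int_parity_cases:
  obtains c :: int where "k = 2 * c" | c where "k = 2 * c + 1"
  by (metis evenE oddE)

lemma position_zz_at: "fst (zz_at k) + snd (zz_at k) = k"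
  by (cases k rule: int_parity_cases) (simp_all add: zz_at_even zz_at_odd)

lemma zz_at_eq_iff [simp]: "zz_at k = zz_at l \<longleftrightarrow> k = l"
  using position_zz_at by metis

lemma zz_iff: "(zz_at k, zz_at l) \<in> zz \<longleftrightarrow> k = l \<or> odd k \<and> \<bar>k - l\<bar> = 1"
  by (cases k rule: int_parity_cases; cases l rule: int_parity_cases;
      simp add: zz_at_even zz_at_odd zz_def zz_set_def; presburger)

lemma zz_intervals:
  "zz_oo a b = zz_at ` {2 * a + 1..2 * b - 1}" "zz_cc a b = zz_at ` {2 * a..2 * b}"
  "zz_co a b = zz_at ` {2 * a..2 * b - 1}" "zz_oc a b = zz_at ` {2 * a + 1..2 * b}"
proof -
  have at: "p \<in> zz_at ` A \<longleftrightarrow> p \<in> zz_set \<and> fst p + snd p \<in> A" for p A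
  proof
    assume "p \<in> zz_set \<and> fst p + snd p \<in> A"
    moreover from this have "p = zz_at (fst p + snd p)"
      by (auto simp: zz_set_def zz_at_def)
    ultimately show "p \<in> zz_at ` A" by (metis imageI)
  next
    assume "p \<in> zz_at ` A"
    then obtain k where "p = zz_at k" "k \<in> A" by blast
    moreover have "zz_at k \<in> zz_set"
      by (cases k rule: int_parity_cases) (simp_all add: zz_at_even zz_at_odd zz_set_def)
    ultimately show "p \<in> zz_set \<and> fst p + snd p \<in> A"
      using position_zz_at[of k] by simp
  qed
  show "zz_oo a b = zz_at ` {2 * a + 1..2 * b - 1}" "zz_cc a b = zz_at ` {2 * a..2 * b}"
    "zz_co a b = zz_at ` {2 * a..2 * b - 1}" "zz_oc a b = zz_at ` {2 * a + 1..2 * b}"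
    unfolding set_eq_iff at by (auto simp: zz_oo_def zz_cc_def zz_co_def zz_oc_def zz_set_def)
qed

lemma zigzag_segment_connected:
  assumes "k \<in> {i..j}" "l \<in> {i..j}"
  shows "(zz_at k, zz_at l) \<in> (Restr (zz \<union> zz\<inverse>) (zz_at ` {i..j}))\<^sup>*" (is "_ \<in> ?R\<^sup>*")
proof -
  have edge: "(zz_at l, zz_at (l + 1)) \<in> ?R" if "l \<in> {i..j}" "l + 1 \<in> {i..j}" for l
    using that zz_iff[of l "l + 1"] zz_iff[of "l + 1" l] by auto
  have up: "(zz_at i, zz_at l) \<in> ?R\<^sup>*" if "i \<le> l" "l \<le> j" for l
    using that
  proof (induction l rule: int_ge_induct)
    case (step l)
    then show ?case using edge[of l]
      by (auto intro: rtrancl_into_rtrancl)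
  qed simp
  have "sym (?R\<^sup>*)" by (intro sym_rtrancl) (auto simp: sym_def)
  then show ?thesis using up[of k] up[of l] assms by (auto dest: symD intro: rtrancl_trans)
qed

text \<open>If \<open>I'\<close> were larger than \<open>I\<close>, connectedness would give a comparable pair that leaves \<open>I\<close>
  inside \<open>I'\<close>. By \<open>sep\<close> some element of \<open>E\<close> lies between two elements of \<open>I'\<close>, so that it is in \<open>I'\<close>
  by convexity, but \<open>E\<close> is disjoint from \<open>I'\<close>.
  The witness \<open>x'\<close> may differ from \<open>x\<close>: the exclusion of an element of one branch can force out an
  element that is reached along another branch.\<close>

lemma interval_eq_if_separated:
  assumes I': "is_interval r I'" and I: "I \<subseteq> I'" "I \<noteq> {}" and E: "E \<inter> I' = {}"
    and sep: "\<And>x y. x \<in> I \<Longrightarrow> y \<in> Field r - I \<Longrightarrow> (x, y) \<in> r \<union> r\<inverse> \<Longrightarrow>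
      \<exists>e\<in>E. \<exists>x'\<in>I. (x', e) \<in> r \<and> (e, y) \<in> r \<or> (y, e) \<in> r \<and> (e, x') \<in> r"
  shows "I' = I"
proof
  obtain x where x: "x \<in> I" using I by blast
  have connected: "\<forall>x\<in>I'. \<forall>y\<in>I'. (x, y) \<in> (Restr (r \<union> r\<inverse>) I')\<^sup>*"
    using I' unfolding is_interval_def by (elim conjE)
  show "I' \<subseteq> I"
  proof
    fix y assume "y \<in> I'"
    then have "(x, y) \<in> (Restr (r \<union> r\<inverse>) I')\<^sup>*" using connected x I by blast
    then show "y \<in> I"
    proof induction
      case (step y z)
      show ?case
      proof (rule ccontr)
        assume "z \<notin> I"
        moreover have "z \<in> Field r" using step by (auto simp: Field_def)
        ultimately obtain e x' where "e \<in> E" "x' \<in> I"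
          "(x', e) \<in> r \<and> (e, z) \<in> r \<or> (z, e) \<in> r \<and> (e, x') \<in> r"
          using sep[of y z] step by blast
        moreover have "z \<in> I'" using step by blast
        ultimately have "e \<in> I'" using is_interval_convex[OF I'] I(1) by blast
        then show False using \<open>e \<in> E\<close> E by blast
      qed
    qed (rule x)
  qed
qed (rule I(1))

text \<open>A segment is a component of the preimage of \<open>I'\<close> iff it maps into \<open>I'\<close> and its neighbours in
  the slice do not. At an end of the slice there is no neighbour to exclude, which is why \<open>E\<close> may
  have fewer than two elements.\<close>

lemma zigzag_component_iff:
  fixes f :: "int \<times> int \<Rightarrow> 'p"
  assumes ij: "L \<le> i" "i \<le> j" "j \<le> R" and r': "r' = Restr zz (zz_at ` {L..R})"
    and I: "I = (\<lambda>k. f (zz_at k)) ` {i..j}"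
    and E: "E = (if L < i then {f (zz_at (i - 1))} else {}) \<union> (if j < R then {f (zz_at (j + 1))} else {})"
      "E \<inter> I = {}"
    and I': "is_interval r I'"
    and sep: "\<And>x y. x \<in> I \<Longrightarrow> y \<in> Field r - I \<Longrightarrow> (x, y) \<in> r \<union> r\<inverse> \<Longrightarrow>
      \<exists>e\<in>E. \<exists>x'\<in>I. (x', e) \<in> r \<and> (e, y) \<in> r \<or> (y, e) \<in> r \<and> (e, x') \<in> r"
  shows "zz_at ` {i..j} \<in> components r' {p \<in> Field r'. f p \<in> I'} \<longleftrightarrow> I' = I"
proof
  have F: "Field r' = zz_at ` {L..R}"
  proof
    have "(zz_at k, zz_at k) \<in> r'" if "k \<in> {L..R}" for k
      using that zz_iff[of k k] unfolding r' by auto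
    then show "zz_at ` {L..R} \<subseteq> Field r'" by (intro image_subsetI FieldI1)
  qed (auto simp: r' Field_def)
  {
    assume C: "zz_at ` {i..j} \<in> components r' {p \<in> Field r'. f p \<in> I'}"
    have "I \<subseteq> I'" using componentsD(2)[OF C] I by auto
    moreover have "I \<noteq> {}" using I ij by auto
    moreover have "E \<inter> I' = {}"
    proof -
      have False if k: "k = i - 1 \<or> k = j + 1" "L \<le> k" "k \<le> R" "f (zz_at k) \<in> I'" for k
      proof -
        define l where "l = (if k = i - 1 then i else j)"
        have l: "l \<in> {i..j}" "\<bar>k - l\<bar> = 1" using k(1) ij by (auto simp: l_def)
        have "(zz_at l, zz_at k) \<in> zz \<union> zz\<inverse>"
          using l(2) unfolding Un_iff converse_iff zz_iff by presburger
        then have edge: "(zz_at l, zz_at k) \<in> r' \<union> r'\<inverse>"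
          using l(1) k(2,3) ij unfolding r' by auto
        have "zz_at k \<in> {p \<in> Field r'. f p \<in> I'}"
          using k(2-4) F by auto
        with l(1) have "zz_at k \<in> zz_at ` {i..j}"
          using componentsD(4)[OF C, rule_format, OF imageI _ edge] by blast
        then show False using k(1) by auto
      qed
      then show ?thesis using E(1) ij by (force split: if_splits)
    qed
    ultimately show "I' = I"
      using sep by (intro interval_eq_if_separated[OF I', where E = E])
  }
  assume eq: "I' = I"
  show "zz_at ` {i..j} \<in> components r' {p \<in> Field r'. f p \<in> I'}"
  proof (rule componentsI)
    show "zz_at ` {i..j} \<noteq> {}" "zz_at ` {i..j} \<subseteq> {p \<in> Field r'. f p \<in> I'}"
      using ij F I eq by auto
    have "Restr (r' \<union> r'\<inverse>) (zz_at ` {i..j}) = Restr (zz \<union> zz\<inverse>) (zz_at ` {i..j})"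
      using ij unfolding r' by auto
    then show "(p, q) \<in> (Restr (r' \<union> r'\<inverse>) (zz_at ` {i..j}))\<^sup>*"
      if "p \<in> zz_at ` {i..j}" "q \<in> zz_at ` {i..j}" for p q
      using zigzag_segment_connected that by auto
    fix p q assume p: "p \<in> zz_at ` {i..j}" and q: "q \<in> {p \<in> Field r'. f p \<in> I'}"
      and pq: "(p, q) \<in> r' \<union> r'\<inverse>"
    obtain k l where k: "p = zz_at k" "k \<in> {i..j}" and l: "q = zz_at l" "l \<in> {L..R}"
      using p q F by auto
    have "k = l \<or> \<bar>k - l\<bar> = 1"
      using pq zz_iff[of k l] zz_iff[of l k] unfolding r' k l by auto
    then have "l \<in> {i..j} \<or> l = i - 1 \<or> l = j + 1" using k(2) by auto
    moreover have "f (zz_at l) \<notin> E" using q E(2) eq l(1) by auto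
    ultimately show "q \<in> zz_at ` {i..j}" using E(1) l by (auto split: if_splits)
  qed
qed

section \<open>The covering map along the slice\<close>

locale slice =
  fixes n m :: int
  assumes n: "n > 1" and m: "m > 1"
begin

abbreviation "N \<equiv> n + m - 1"

lemma mod_N: "0 \<le> c \<Longrightarrow> c < N \<Longrightarrow> c mod N = c" "- N \<le> c \<Longrightarrow> c < 0 \<Longrightarrow> c mod N = N + c"
proof -
  show "c mod N = c" if "0 \<le> c" "c < N"
    using that by (rule mod_pos_pos_trivial)
  assume "- N \<le> c" "c < 0"
  then have "(c + N) mod N = c + N" by (intro mod_pos_pos_trivial) auto
  then show "c mod N = N + c" by simp
qed

text \<open>From left to right, the slice climbs down the second chain from \<open>n + 1\<close> to \<open>0\<close>, up the first
  chain to \<open>n\<close>, and down the whole second chain to \<open>0\<close> again.\<close>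

lemma zeta_even:
  assumes "2 - m \<le> c" "c \<le> N"
  shows "zeta n m (zz_at (2 * c)) = (if c \<le> 0 then N + c else c)"
  using assms n m mod_N[of "c - 1"] by (auto simp: zz_at_even zeta_def Let_def)

lemma zeta_odd:
  assumes "1 - m \<le> c" "c \<le> N"
  shows "zeta n m (zz_at (2 * c + 1)) =
    (if c < 0 then N + c + 1 else if c = 0 \<or> c = N then 0 else if c < n then c else c + 1)"
  using assms n m mod_N[of c] by (auto simp: zz_at_odd zeta_def Let_def)

lemma zz_slice_eq: "zz_slice n m = Restr zz (zz_at ` {3 - 2 * m..2 * N + 1})"
  unfolding zz_slice_def zz_slice_set_def zz_intervals by (simp add: algebra_simps)

lemma zeta_mono:
  assumes "(p, q) \<in> zz_slice n m"
  shows "(zeta n m p, zeta n m q) \<in> bipath n m"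
proof -
  obtain k l where k: "p = zz_at k" "3 - 2 * m \<le> k" "k \<le> 2 * N + 1"
    and l: "q = zz_at l" "3 - 2 * m \<le> l" "l \<le> 2 * N + 1"
    and kl: "k = l \<or> odd k \<and> \<bar>k - l\<bar> = 1"
    using assms zz_iff unfolding zz_slice_eq by auto
  show ?thesis
  proof (cases k rule: int_parity_cases)
    case (1 c)
    then have "k = l" using kl by simp
    then show ?thesis
      using 1 k l zeta_even[of c] n m by (auto simp: bipath_iff)
  next
    case (2 c)
    then have "l = 2 * c + 1 \<or> l = 2 * c \<or> l = 2 * (c + 1)" using kl by arith
    then consider "l = 2 * c + 1" | "l = 2 * c" | "l = 2 * (c + 1)" by blast
    then show ?thesis
      by cases (use 2 k l zeta_odd[of c] zeta_even[of c] zeta_even[of "c + 1"] n m in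
        \<open>auto simp: bipath_iff\<close>)
  qed
qed

lemma zeta_image_eqI:
  assumes "3 - 2 * m \<le> i" "j \<le> 2 * N + 1"
    and "\<And>c. i \<le> 2 * c \<Longrightarrow> 2 * c \<le> j \<Longrightarrow> (if c \<le> 0 then N + c else c) \<in> I"
    and "\<And>c. i \<le> 2 * c + 1 \<Longrightarrow> 2 * c + 1 \<le> j \<Longrightarrow>
      (if c < 0 then N + c + 1 else if c = 0 \<or> c = N then 0 else if c < n then c else c + 1) \<in> I"
    and "\<And>x. x \<in> I \<Longrightarrow> \<exists>k\<in>{i..j}. x = zeta n m (zz_at k)"
  shows "I = (\<lambda>k. zeta n m (zz_at k)) ` {i..j}"
proof (intro equalityI subsetI)
  fix x assume "x \<in> (\<lambda>k. zeta n m (zz_at k)) ` {i..j}"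
  then obtain k where k: "i \<le> k" "k \<le> j" "x = zeta n m (zz_at k)" by auto
  show "x \<in> I"
  proof (cases k rule: int_parity_cases)
    case (1 c)
    then show ?thesis using k assms(1,2) assms(3)[of c] zeta_even[of c] by simp
  next
    case (2 c)
    then show ?thesis using k assms(1,2) assms(4)[of c] zeta_odd[of c] by simp
  qed
qed (use assms(5) in blast)

text \<open>The hypothesis on \<open>K\<close> in \<open>interval_mult_pullback\<close>, for the segment of positions from \<open>i\<close> to
  \<open>j\<close>.\<close>

abbreviation component :: "int \<Rightarrow> int \<Rightarrow> int set \<Rightarrow> bool" where
  "component i j I \<equiv> (\<forall>I'. is_interval (bipath n m) I' \<longrightarrow>
     zz_at ` {i..j} \<in> components (zz_slice n m) {p \<in> Field (zz_slice n m). zeta n m p \<in> I'} \<longleftrightarrow> I' = I)"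

text \<open>The left and the right neighbour are kept apart, in \<open>E1\<close> and \<open>E2\<close>, because either can be
  missing at an end of the slice.\<close>

lemma componentI:
  assumes "3 - 2 * m \<le> i" "i \<le> j" "j \<le> 2 * N + 1"
    and "I = (\<lambda>k. zeta n m (zz_at k)) ` {i..j}"
    and E: "E1 = (if 3 - 2 * m < i then {zeta n m (zz_at (i - 1))} else {})"
      "E2 = (if j < 2 * N + 1 then {zeta n m (zz_at (j + 1))} else {})" "(E1 \<union> E2) \<inter> I = {}"
    and "\<And>x y. x \<in> I \<Longrightarrow> 0 \<le> y \<Longrightarrow> y \<le> N \<Longrightarrow> y \<notin> I \<Longrightarrow>
      (x, y) \<in> bipath n m \<or> (y, x) \<in> bipath n m \<Longrightarrow> \<exists>e\<in>E1 \<union> E2. \<exists>x'\<in>I.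
        (x', e) \<in> bipath n m \<and> (e, y) \<in> bipath n m \<or> (y, e) \<in> bipath n m \<and> (e, x') \<in> bipath n m"
  shows "component i j I"
proof (intro allI impI)
  fix I' assume I': "is_interval (bipath n m) I'"
  show "zz_at ` {i..j} \<in> components (zz_slice n m) {p \<in> Field (zz_slice n m). zeta n m p \<in> I'} \<longleftrightarrow> I' = I"
    by (rule zigzag_component_iff[OF assms(1-3) zz_slice_eq assms(4) _ E(3) I'])
      (use E(1,2) assms(8) Field_bipath[OF n m] in \<open>auto simp: bipath_set_def\<close>)
qed

lemma full_component: "component (3 - 2 * m) (2 * N + 1) (bipath_set n m)"
proof (rule componentI[where ?E1.0 = "{}" and ?E2.0 = "{}"])
  show "bipath_set n m = (\<lambda>k. zeta n m (zz_at k)) ` {3 - 2 * m..2 * N + 1}"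
  proof (rule zeta_image_eqI)
    fix x assume x: "x \<in> bipath_set n m"
    show "\<exists>k\<in>{3 - 2 * m..2 * N + 1}. x = zeta n m (zz_at k)"
      using x n m zeta_odd[of 0] zeta_even[of x]
      by (intro bexI[of _ "if x = 0 then 1 else 2 * x"]) (auto simp: bipath_set_def)
  qed (use n m in \<open>auto simp: bipath_set_def\<close>)
qed (use n m in \<open>auto simp: bipath_set_def\<close>)

lemma left_component_zero:
  assumes i: "0 \<le> i" "i \<le> n - 1"
  shows "component 1 (2 * i + 1) (left_interval n m i 0)"
proof -
  have I: "left_interval n m i 0 = {0..i}"
    using i n m by (auto simp: left_interval_def segment_def bipath_iff)
  show ?thesis
    unfolding I
  proof (rule componentI[where ?E1.0 = "{N}" and ?E2.0 = "{i + 1}"])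
    show "{0..i} = (\<lambda>k. zeta n m (zz_at k)) ` {1..2 * i + 1}"
    proof (rule zeta_image_eqI)
      fix x assume x: "x \<in> {0..i}"
      show "\<exists>k\<in>{1..2 * i + 1}. x = zeta n m (zz_at k)"
        using x i n m zeta_odd[of x] by (intro bexI[of _ "2 * x + 1"]) auto
    qed (use i n m in auto)
    have "1 - 1 = 2 * (0 :: int)" "2 * i + 1 + 1 = 2 * (i + 1)" by simp_all
    then show "{N} = (if 3 - 2 * m < 1 then {zeta n m (zz_at (1 - 1))} else {})"
      "{i + 1} = (if 2 * i + 1 < 2 * N + 1 then {zeta n m (zz_at (2 * i + 1 + 1))} else {})"
      using zeta_even[of "0"] zeta_even[of "i + 1"] i n m by (simp_all only:) auto
    show "\<exists>e\<in>{N} \<union> {i + 1}. \<exists>x'\<in>{0..i}. (x', e) \<in> bipath n m \<and> (e, y) \<in> bipath n m \<or>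
        (y, e) \<in> bipath n m \<and> (e, x') \<in> bipath n m"
      if "x \<in> {0..i}" "0 \<le> y" "y \<le> N" "y \<notin> {0..i}"
        "(x, y) \<in> bipath n m \<or> (y, x) \<in> bipath n m" for x y
      using that i n m by (auto simp: bipath_iff)
  qed (use i n m in auto)
qed

text \<open>For \<open>j = n + 1\<close> the segment starts at the left end of the slice, and only \<open>i + 1\<close> is excluded by
  a neighbour. This also excludes \<open>n\<close>, because \<open>i + 1\<close> lies between \<open>0\<close> and \<open>n\<close>.\<close>

lemma left_component:
  assumes i: "0 \<le> i" "i \<le> n - 1" and j: "n + 1 \<le> j" "j \<le> N"
  shows "component (2 * (j - n - m) + 1) (2 * i + 1) (left_interval n m i j)"
proof -
  let ?I = "{0..i} \<union> {j..N}"
  have I: "left_interval n m i j = ?I"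
  proof (rule set_eqI)
    fix x
    have "(x \<in> segment (bipath n m) 0 i) = (x \<in> {0..i})"
      using i n m by (auto simp: segment_def bipath_iff)
    moreover have "(x \<in> segment (bipath n m) 0 j) = (x = 0 \<or> x \<in> {j..N})"
      using j n m by (auto simp: segment_def bipath_iff)
    ultimately show "(x \<in> left_interval n m i j) = (x \<in> ?I)"
      using i by (auto simp: left_interval_def)
  qed
  show ?thesis
    unfolding I
  proof (rule componentI[where ?E1.0 = "if j = n + 1 then {} else {j - 1}" and ?E2.0 = "{i + 1}"])
    show "?I = (\<lambda>k. zeta n m (zz_at k)) ` {2 * (j - n - m) + 1..2 * i + 1}"
    proof (rule zeta_image_eqI)
      fix x assume x: "x \<in> ?I"
      \<comment> \<open>The second chain is met to the left of position 1, one period of \<open>2 * N\<close> before it is met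
        to the right of \<open>n\<close>.\<close>
      show "\<exists>k\<in>{2 * (j - n - m) + 1..2 * i + 1}. x = zeta n m (zz_at k)"
        using x i j n m zeta_odd[of x] zeta_odd[of "x - N - 1"]
        by (intro bexI[of _ "if x \<le> i then 2 * x + 1 else 2 * (x - N - 1) + 1"]) auto
    qed (use i j n m in auto)
    have "2 * (j - n - m) + 1 - 1 = 2 * (j - n - m)" "2 * i + 1 + 1 = 2 * (i + 1)" by simp_all
    then show "(if j = n + 1 then {} else {j - 1}) =
        (if 3 - 2 * m < 2 * (j - n - m) + 1
         then {zeta n m (zz_at (2 * (j - n - m) + 1 - 1))} else {})"
      "{i + 1} = (if 2 * i + 1 < 2 * N + 1 then {zeta n m (zz_at (2 * i + 1 + 1))} else {})"
      using zeta_even[of "j - n - m"] zeta_even[of "i + 1"] i j n m by (simp_all only:) auto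
    show "\<exists>e\<in>(if j = n + 1 then {} else {j - 1}) \<union> {i + 1}. \<exists>x'\<in>?I.
        (x', e) \<in> bipath n m \<and> (e, y) \<in> bipath n m \<or>
        (y, e) \<in> bipath n m \<and> (e, x') \<in> bipath n m"
      if "x \<in> ?I" "0 \<le> y" "y \<le> N" "y \<notin> ?I"
        "(x, y) \<in> bipath n m \<or> (y, x) \<in> bipath n m" for x y
    proof (cases "y \<le> n")
      case True
      then show ?thesis using that i j n m by (intro bexI[of _ "i + 1"] bexI[of _ 0]) (auto simp: bipath_iff)
    next
      case False
      then show ?thesis using that i j n m by (intro bexI[of _ "j - 1"] bexI[of _ 0]) (auto simp: bipath_iff)
    qed
  qed (use i j n m in auto)
qed

lemma right_component:
  assumes i: "1 \<le> i" "i \<le> n" and j: "n \<le> j" "j \<le> N"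
  shows "component (2 * i) (2 * j) (right_interval n m i j)"
proof -
  have I: "right_interval n m i j = {i..j}"
    using i j n m by (auto simp: right_interval_def segment_def bipath_iff)
  let ?e = "if j = N then 0 else j + 1"
  show ?thesis
    unfolding I
  proof (rule componentI[where ?E1.0 = "{i - 1}" and ?E2.0 = "{?e}"])
    show "{i..j} = (\<lambda>k. zeta n m (zz_at k)) ` {2 * i..2 * j}"
    proof (rule zeta_image_eqI)
      fix x assume x: "x \<in> {i..j}"
      show "\<exists>k\<in>{2 * i..2 * j}. x = zeta n m (zz_at k)"
        using x i j n m zeta_even[of x] by (intro bexI[of _ "2 * x"]) auto
    qed (use i j n m in auto)
    have "2 * i - 1 = 2 * (i - 1) + 1" "2 * j + 1 = 2 * (j) + 1" by simp_all
    then show "{i - 1} = (if 3 - 2 * m < 2 * i then {zeta n m (zz_at (2 * i - 1))} else {})"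
      "{?e} = (if 2 * j < 2 * N + 1 then {zeta n m (zz_at (2 * j + 1))} else {})"
      using zeta_odd[of "i - 1"] zeta_odd[of "j"] i j n m by (simp_all only:) auto
    show "\<exists>e\<in>{i - 1} \<union> {?e}. \<exists>x'\<in>{i..j}. (x', e) \<in> bipath n m \<and> (e, y) \<in> bipath n m \<or>
        (y, e) \<in> bipath n m \<and> (e, x') \<in> bipath n m"
      if "x \<in> {i..j}" "0 \<le> y" "y \<le> N" "y \<notin> {i..j}"
        "(x, y) \<in> bipath n m \<or> (y, x) \<in> bipath n m" for x y
    proof (cases "y < i")
      case True
      then show ?thesis using that i j n m by (intro bexI[of _ "i - 1"] bexI[of _ n]) (auto simp: bipath_iff)
    next
      case False
      then show ?thesis using that i j n m by (intro bexI[of _ ?e] bexI[of _ n]) (auto simp: bipath_iff)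
    qed
  qed (use i j n m in auto)
qed

lemma top_component:
  assumes ij: "1 \<le> i" "i \<le> j" "j \<le> n - 1"
  shows "component (2 * i) (2 * j + 1) (top_interval n m i j)"
proof -
  have I: "top_interval n m i j = {i..j}"
    using ij n m by (auto simp: top_interval_def segment_def bipath_iff)
  show ?thesis
    unfolding I
  proof (rule componentI[where ?E1.0 = "{i - 1}" and ?E2.0 = "{j + 1}"])
    show "{i..j} = (\<lambda>k. zeta n m (zz_at k)) ` {2 * i..2 * j + 1}"
    proof (rule zeta_image_eqI)
      fix x assume x: "x \<in> {i..j}"
      show "\<exists>k\<in>{2 * i..2 * j + 1}. x = zeta n m (zz_at k)"
        using x ij n m zeta_even[of x] by (intro bexI[of _ "2 * x"]) auto
    qed (use ij n m in auto)
    have "2 * i - 1 = 2 * (i - 1) + 1" "2 * j + 1 + 1 = 2 * (j + 1)" by simp_all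
    then show "{i - 1} = (if 3 - 2 * m < 2 * i then {zeta n m (zz_at (2 * i - 1))} else {})"
      "{j + 1} = (if 2 * j + 1 < 2 * N + 1 then {zeta n m (zz_at (2 * j + 1 + 1))} else {})"
      using zeta_odd[of "i - 1"] zeta_even[of "j + 1"] ij n m by (simp_all only:) auto
    show "\<exists>e\<in>{i - 1} \<union> {j + 1}. \<exists>x'\<in>{i..j}. (x', e) \<in> bipath n m \<and> (e, y) \<in> bipath n m \<or>
        (y, e) \<in> bipath n m \<and> (e, x') \<in> bipath n m"
      if "x \<in> {i..j}" "0 \<le> y" "y \<le> N" "y \<notin> {i..j}"
        "(x, y) \<in> bipath n m \<or> (y, x) \<in> bipath n m" for x y
      using that ij n m by (auto simp: bipath_iff)
  qed (use ij n m in auto)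
qed

lemma bottom_component:
  assumes ij: "n + 1 \<le> i" "i \<le> j" "j \<le> N"
  shows "component (2 * (i - 1) + 1) (2 * j) (bottom_interval n m i j)"
proof -
  have I: "bottom_interval n m i j = {i..j}"
    using ij n m by (auto simp: bottom_interval_def segment_def bipath_iff)
  let ?e = "if j = N then 0 else j + 1"
  show ?thesis
    unfolding I
  proof (rule componentI[where ?E1.0 = "{i - 1}" and ?E2.0 = "{?e}"])
    show "{i..j} = (\<lambda>k. zeta n m (zz_at k)) ` {2 * (i - 1) + 1..2 * j}"
    proof (rule zeta_image_eqI)
      fix x assume x: "x \<in> {i..j}"
      show "\<exists>k\<in>{2 * (i - 1) + 1..2 * j}. x = zeta n m (zz_at k)"
        using x ij n m zeta_even[of x] by (intro bexI[of _ "2 * x"]) auto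
    qed (use ij n m in auto)
    have "2 * (i - 1) + 1 - 1 = 2 * (i - 1)" "2 * j + 1 = 2 * (j) + 1" by simp_all
    then show "{i - 1} = (if 3 - 2 * m < 2 * (i - 1) + 1 then {zeta n m (zz_at (2 * (i - 1) + 1 - 1))} else {})"
      "{?e} = (if 2 * j < 2 * N + 1 then {zeta n m (zz_at (2 * j + 1))} else {})"
      using zeta_even[of "i - 1"] zeta_odd[of "j"] ij n m by (simp_all only:) auto
    show "\<exists>e\<in>{i - 1} \<union> {?e}. \<exists>x'\<in>{i..j}. (x', e) \<in> bipath n m \<and> (e, y) \<in> bipath n m \<or>
        (y, e) \<in> bipath n m \<and> (e, x') \<in> bipath n m"
      if "x \<in> {i..j}" "0 \<le> y" "y \<le> N" "y \<notin> {i..j}"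
        "(x, y) \<in> bipath n m \<or> (y, x) \<in> bipath n m" for x y
      using that ij n m by (auto simp: bipath_iff)
  qed (use ij n m in auto)
qed

end

theorem theorem4p1:
  fixes n m :: int
    and M :: "(int, 'k::field, 'v::ab_group_add) persistence"
  assumes "n > 1" and "m > 1"
    and "persistence_module (bipath n m) M"
  shows "let \<mu> = interval_mult (bipath n m) M;
        \<mu>' = interval_mult (zz_slice n m) (restrict_slice n m M)
    in
    \<mu> (bipath_set n m) = \<mu>' (zz_slice_set n m) \<and>
    (\<forall>i\<in>{0..n - 1}. \<mu> (left_interval n m i 0) = \<mu>' (zz_oo 0 (i + 1))) \<and>
    (\<forall>i\<in>{0..n - 1}. \<forall>j\<in>{n + 1..n + m - 1}.
        \<mu> (left_interval n m i j) = \<mu>' (zz_oo (- n - m + j) (i + 1))) \<and>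
    (\<forall>i\<in>{1..n}. \<forall>j\<in>{n..n + m - 1}. \<mu> (right_interval n m i j) = \<mu>' (zz_cc i j)) \<and>
    (\<forall>i\<in>{1..n - 1}. \<forall>j\<in>{1..n - 1}. (i, j) \<in> bipath n m \<longrightarrow>
        \<mu> (top_interval n m i j) = \<mu>' (zz_co i (j + 1))) \<and>
    (\<forall>i\<in>{n + 1..n + m - 1}. \<forall>j\<in>{n + 1..n + m - 1}. (j, i) \<in> bipath n m \<longrightarrow>
        \<mu> (bottom_interval n m i j) = \<mu>' (zz_oc (i - 1) j))"
proof -
  interpret slice n m using assms by unfold_locales
  obtain S :: "nat set" and J x l where basis: "interval_basis (bipath n m) M S J x l"
    using bipath_interval_basis_exists[OF assms] by blast
  have "Field (zz_slice n m) \<subseteq> zz_at ` {3 - 2 * m..2 * N + 1}"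
    unfolding zz_slice_eq by (auto simp: Field_def)
  then have fin: "finite (Field (zz_slice n m))"
    by (rule finite_subset) simp
  have mult: "interval_mult (bipath n m) M I =
      interval_mult (zz_slice n m) (restrict_slice n m M) (zz_at ` {i..j})"
    if "component i j I" for i j I
    unfolding restrict_slice_def
    by (rule interval_mult_pullback[OF fin zeta_mono assms(3) basis]) (use that in blast)+
  have top_le: "i \<le> j" if "1 \<le> i" "j \<le> n - 1" "(i, j) \<in> bipath n m" for i j
    using that n m by (auto simp: bipath_iff)
  have bottom_le: "i \<le> j" if "n + 1 \<le> i" "n + 1 \<le> j" "(j, i) \<in> bipath n m" for i j
    using that n m by (auto simp: bipath_iff)
  show ?thesis
    unfolding Let_def zz_slice_set_def zz_intervals
  proof (intro conjI ballI impI, goal_cases)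
    case 1
    have "2 * (- m + 1) + 1 = 3 - 2 * m" "2 * (n + m) - 1 = 2 * N + 1" by simp_all
    then show ?case using mult[OF full_component] by (simp only:)
  next
    case (2 i)
    have "2 * 0 + 1 = (1 :: int)" "2 * (i + 1) - 1 = 2 * i + 1" by simp_all
    then show ?case by (simp only:) (rule mult[OF left_component_zero], use 2 in simp_all)
  next
    case (3 i j)
    have "2 * (- n - m + j) + 1 = 2 * (j - n - m) + 1" "2 * (i + 1) - 1 = 2 * i + 1" by simp_all
    then show ?case by (simp only:) (rule mult[OF left_component], use 3 in simp_all)
  next
    case (4 i j)
    then show ?case by (intro mult[OF right_component]) simp_all
  next
    case (5 i j)
    have "2 * (j + 1) - 1 = 2 * j + 1" by simp
    then show ?case by (simp only:) (rule mult[OF top_component], use 5 top_le[of i j] in simp_all)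
  next
    case (6 i j)
    then show ?case using bottom_le[of i j] by (intro mult[OF bottom_component]) simp_all
  qed
qed

end
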